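(* Let $N\ge 3$ and for $1\le k<N/2$ let $t_k=\tan(\pi/N)/\tan(k\pi/N)$. Then the set $T=\{t_k: 1\le k<N/2,\ \gcd(k,N)=1\}$ is linearly independent over $\mathbb{Q}$, and every $t_j$ with $1\le j<N/2$ is a $\mathbb{Q}$-linear combination of elements of $T$. In particular the $\mathbb{Q}$-span of all the $t_k$ has dimension $|T|=\varphi(N)/2$.
   Context: The $t_k$ are the scales of the regular $N$-gon; those with $\gcd(k,N)=1$ are the primitive scales. $\varphi$ is Euler's totient function. *)

theory Defs
  imports "HOL-Analysis.Analysis" "HOL-Number_Theory.Number_Theory"
begin

definition scale :: "nat \<Rightarrow> nat \<Rightarrow> real" where
  "scale N k = tan (pi / real N) / tan (real k * pi / real N)"

definition scale_idx :: "nat \<Rightarrow> nat set" where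
  "scale_idx N = {k. 1 \<le> k \<and> 2 * k < N}"

definition prim_idx :: "nat \<Rightarrow> nat set" where
  "prim_idx N = {k. 1 \<le> k \<and> 2 * k < N \<and> coprime k N}"

end

theory Submission
  imports Defs
begin

text \<open>Up to the factor \<open>tan (pi / N)\<close>, the scales are the numbers \<open>cot (k * pi / N)\<close>, which are \<open>-\<i>\<close> times
  elements of the cyclotomic field. By Galois conjugation, a rational relation between the primitive
  ones, extended to an odd \<open>N\<close>-periodic function \<open>f\<close>, holds for all translates \<open>k \<mapsto> f (a * k)\<close> with
  \<open>a\<close> prime to \<open>N\<close>. If \<open>f\<close> is nonzero, the translation-invariant space it generates contains an odd
  Dirichlet character \<open>\<psi>\<close> modulo \<open>N\<close>. The partial fractions of the cotangent turn the relation for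
  \<open>\<psi>\<close> into \<open>(\<Sum>n. \<psi> n / n) = 0\<close>, that is \<open>L(1, \<psi>) = 0\<close>, contradicting Dirichlet's nonvanishing theorem. The
  spanning property follows from the distribution relation
  \<open>(\<Sum>l<p. cot (x + l * pi / p)) = p * cot (p * x)\<close>.\<close>

section \<open>Conjugate roots of unity\<close>

text \<open>Conjugation acts only on exponents of \<open>cis (2 * pi / real N)\<close>, so no Galois
  group or field degree appears: a relation cleared of denominators becomes the vanishing of an
  integer polynomial at a root of unity, and this passes to the powers prime to \<open>N\<close>.
  Two facts permit this reading. The identity \<open>(\<Sum>j<N. j * w ^ j) = N / (w - 1)\<close>
  turns the cotangent into a polynomial in the root of unity, and oddness of \<open>f\<close>
  cancels its constant term; the imaginary unit then factors out even when it lies outside the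
  cyclotomic field. The support of \<open>f\<close> on residues prime to \<open>N\<close> is what
  makes independence work: an eigenfunction supported there cannot vanish at 1, so it can be
  normalised to a character. That character may be imprimitive, and nonvanishing is proved for every
  nonprincipal character modulo \<open>N\<close>, with Abel summation on the real line in place of
  analytic continuation. Real characters need an argument of their own: their square is principal,
  and its pole is one more than the 3-4-1 inequality can absorb.\<close>

lemma prime_dvd_power_minus_self:
  fixes a :: int
  assumes "prime p"
  shows "int p dvd a ^ p - a"
proof -
  have nat_case: "[b ^ p = b] (mod p)" for b :: nat
  proof (cases "p dvd b")
    case True
    then show ?thesis
      using assms by (metis cong_def dvd_imp_mod_0 dvd_power dvd_trans prime_gt_0_nat)
  next
    case False
    then have "[b ^ (p - 1) * b = 1 * b] (mod p)"
      using assms fermat_theorem by (intro cong_scalar_right) auto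
    then show ?thesis
      using assms by (metis mult_1 power_minus_mult prime_gt_0_nat)
  qed
  have p: "p > 0" using assms prime_gt_0_nat by blast
  define b where "b = nat (a mod int p)"
  have b: "[a = int b] (mod int p)"
    using p by (simp add: b_def cong_def)
  have "[a ^ p = int b ^ p] (mod int p)"
    using b by (rule cong_pow)
  also have "[int b ^ p = int b] (mod int p)"
    using nat_case[of b] by (metis cong_int_iff of_nat_power)
  also have "[int b = a] (mod int p)"
    using b by (rule cong_sym)
  finally show ?thesis
    by (simp add: cong_iff_dvd_diff)
qed

text \<open>The ring Z[z]. Its polynomials are complex ones with integer coefficients, so that they
  evaluate at \<open>z\<close> without a coercion.\<close>

definition int_adjoin :: "complex \<Rightarrow> complex set" where
  "int_adjoin z = {poly P z | P. \<forall>i. Polynomial.coeff P i \<in> \<int>}"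

lemma int_adjoin_self: "z \<in> int_adjoin z"
  unfolding int_adjoin_def
  by (intro CollectI exI[of _ "[:0, 1:]"]) (auto simp: coeff_pCons split: nat.splits)

lemma int_adjoin_Ints: "x \<in> \<int> \<Longrightarrow> x \<in> int_adjoin z"
  unfolding int_adjoin_def
  by (intro CollectI exI[of _ "[:x:]"]) (auto simp: coeff_pCons split: nat.splits)

lemma int_adjoin_add: "x \<in> int_adjoin z \<Longrightarrow> y \<in> int_adjoin z \<Longrightarrow> x + y \<in> int_adjoin z"
proof -
  assume "x \<in> int_adjoin z" "y \<in> int_adjoin z"
  then obtain P Q where "x = poly P z" "\<forall>i. Polynomial.coeff P i \<in> \<int>"
      "y = poly Q z" "\<forall>i. Polynomial.coeff Q i \<in> \<int>"
    unfolding int_adjoin_def by blast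
  then show ?thesis unfolding int_adjoin_def
    by (intro CollectI exI[of _ "P + Q"]) auto
qed

lemma int_adjoin_mult: "x \<in> int_adjoin z \<Longrightarrow> y \<in> int_adjoin z \<Longrightarrow> x * y \<in> int_adjoin z"
proof -
  assume "x \<in> int_adjoin z" "y \<in> int_adjoin z"
  then obtain P Q where "x = poly P z" "\<forall>i. Polynomial.coeff P i \<in> \<int>" "y = poly Q z" "\<forall>i. Polynomial.coeff Q i \<in> \<int>"
    unfolding int_adjoin_def by blast
  then show ?thesis unfolding int_adjoin_def
    by (intro CollectI exI[of _ "P * Q"]) (auto simp: coeff_mult intro!: Ints_sum Ints_mult)
qed

lemma int_adjoin_power: "x \<in> int_adjoin z \<Longrightarrow> x ^ n \<in> int_adjoin z"
  by (induction n) (auto intro: int_adjoin_mult int_adjoin_Ints)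

lemma int_adjoin_sum: "(\<And>k. k \<in> K \<Longrightarrow> f k \<in> int_adjoin z) \<Longrightarrow> sum f K \<in> int_adjoin z"
  by (induction K rule: infinite_finite_induct) (auto intro: int_adjoin_add int_adjoin_Ints)

lemma int_adjoin_poly:
  assumes "\<forall>i. Polynomial.coeff P i \<in> \<int>" "x \<in> int_adjoin z"
  shows "poly P x \<in> int_adjoin z"
  using assms unfolding poly_altdef
  by (intro int_adjoin_sum int_adjoin_mult int_adjoin_power) (auto intro: int_adjoin_Ints)

text \<open>The middle binomial coefficients are multiples of \<open>p\<close>. Keeping the
  remainder as \<open>of_nat p * r\<close> with \<open>r\<close> in Z[z] avoids forming a quotient
  ring.\<close>

lemma freshmans_dream_int_adjoin:
  assumes p: "prime p" and "x \<in> int_adjoin z" "y \<in> int_adjoin z"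
  shows "\<exists>r \<in> int_adjoin z. (x + y) ^ p = x ^ p + y ^ p + of_nat p * r"
proof -
  have p0: "p > 0" using p prime_gt_0_nat by blast
  define c where "c k = (p choose k) div p" for k
  have c: "p choose k = p * c k" if "k \<in> {0<..<p}" for k
    using dvd_choose_prime[of k p] that p p0 unfolding c_def by auto
  define r where "r = (\<Sum>k\<in>{0<..<p}. of_nat (c k) * x ^ k * y ^ (p - k))"
  have "{..p} = insert 0 (insert p {0<..<p})" using p0 by auto
  then have "(x + y) ^ p = x ^ p + y ^ p + (\<Sum>k\<in>{0<..<p}. of_nat (p choose k) * x ^ k * y ^ (p - k))"
    using p0 by (simp add: binomial_ring)
  also have "(\<Sum>k\<in>{0<..<p}. of_nat (p choose k) * x ^ k * y ^ (p - k)) = of_nat p * r"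
    unfolding r_def sum_distrib_left by (intro sum.cong) (auto simp: c)
  finally have "(x + y) ^ p = x ^ p + y ^ p + of_nat p * r" .
  moreover have "r \<in> int_adjoin z"
    unfolding r_def using assms
    by (intro int_adjoin_sum int_adjoin_mult int_adjoin_power) (auto intro: int_adjoin_Ints)
  ultimately show ?thesis by blast
qed

text \<open>Induction along Horner's scheme \<open>a + x * poly P x\<close>: the binomial step
  separates the summands, and Fermat replaces \<open>a ^ p\<close> by \<open>a\<close>. At a root
  \<open>x\<close> of \<open>P\<close> this makes the value at \<open>x ^ p\<close> a multiple of
  \<open>p\<close> in Z[z].\<close>

lemma frobenius_int_poly:
  assumes p: "prime p" and "\<forall>i. Polynomial.coeff P i \<in> \<int>" and x: "x \<in> int_adjoin z"
  shows "\<exists>r \<in> int_adjoin z. poly P (x ^ p) = poly P x ^ p + of_nat p * r"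
  using assms(2)
proof (induction P)
  case 0
  then show ?case
    using p by (intro bexI[of _ 0]) (auto intro: int_adjoin_Ints simp: prime_gt_0_nat)
next
  case (pCons a P)
  have P: "\<forall>i. Polynomial.coeff P i \<in> \<int>" using pCons.prems by (metis coeff_pCons_Suc)
  have "a \<in> \<int>" using pCons.prems by (metis coeff_pCons_0)
  then obtain m where m: "a = of_int m" by (auto elim: Ints_cases)
  obtain q where "m ^ p - m = int p * q"
    using prime_dvd_power_minus_self[OF p] by (auto elim: dvdE)
  then have "m ^ p = m + int p * q" by simp
  then have q: "a ^ p = a + of_nat p * of_int q"
    unfolding m by (metis of_int_add of_int_mult of_int_of_nat_eq of_int_power)
  obtain r where r: "r \<in> int_adjoin z" "poly P (x ^ p) = poly P x ^ p + of_nat p * r"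
    using pCons.IH[OF P] by auto
  have xP: "x * poly P x \<in> int_adjoin z"
    using x P by (intro int_adjoin_mult int_adjoin_poly)
  obtain s where s: "s \<in> int_adjoin z"
      "(a + x * poly P x) ^ p = a ^ p + (x * poly P x) ^ p + of_nat p * s"
    using freshmans_dream_int_adjoin[OF p _ xP, of a] \<open>a \<in> \<int>\<close> int_adjoin_Ints by blast
  have "poly (pCons a P) (x ^ p) = a + x ^ p * (poly P x ^ p + of_nat p * r)"
    using r by simp
  also have "\<dots> = (a + x * poly P x) ^ p + of_nat p * (- of_int q + x ^ p * r + (-1) * s)"
    unfolding s(2) q by (simp add: algebra_simps)
  finally have "poly (pCons a P) (x ^ p) =
      poly (pCons a P) x ^ p + of_nat p * (- of_int q + x ^ p * r + (-1) * s)"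
    by simp
  moreover have "- of_int q + x ^ p * r + (-1) * s \<in> int_adjoin z"
    using r s x by (intro int_adjoin_add int_adjoin_mult int_adjoin_power) (auto intro: int_adjoin_Ints)
  ultimately show ?case by blast
qed

text \<open>A linear map prescribed on the independent set \<open>{b}\<close> extends to the whole
  rational vector space. Such a functional turns divisibility of a nonzero \<open>b\<close> in Z[z]
  into divisibility of an integer.\<close>

lemma exists_rat_linear_functional:
  assumes "b \<noteq> (0::complex)"
  shows "\<exists>\<phi> :: complex \<Rightarrow> rat. \<phi> b = 1 \<and> (\<forall>x y. \<phi> (x + y) = \<phi> x + \<phi> y)
    \<and> (\<forall>q x. \<phi> (of_rat q * x) = q * \<phi> x)"
proof -
  interpret vector_space_pair "\<lambda>(q::rat) (x::complex). of_rat q * x" "\<lambda>(q::rat) (x::rat). q * x"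
    by unfold_locales (auto simp: algebra_simps of_rat_add of_rat_mult)
  have "vs1.independent {b}"
    using assms by (simp add: vs1.dependent_single)
  then obtain g where g: "Vector_Spaces.linear (\<lambda>(q::rat) (x::complex). of_rat q * x) (\<lambda>(q::rat) (x::rat). q * x) g"
      "g b = 1"
    using linear_independent_extend[of "{b}" "\<lambda>_. 1"] by auto
  then show ?thesis
    using linear_add[OF g(1)] linear_scale[OF g(1)] by (intro exI[of _ g]) auto
qed

lemma exists_common_denominator:
  assumes "finite A"
  shows "\<exists>D :: int. D > 0 \<and> (\<forall>k\<in>A. of_int D * (f k :: rat) \<in> \<int>)"
  using assms
proof (induction A)
  case empty
  show ?case by (intro exI[of _ 1]) auto
next
  case (insert a A)
  then obtain D :: int where D: "D > 0" "\<forall>k\<in>A. of_int D * f k \<in> \<int>" by blast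
  obtain m n :: int where mn: "n > 0" "f a = of_int m / of_int n"
    by (metis Fract_of_int_quotient quotient_of_denom_pos quotient_of_div surj_pair)
  have "of_int (n * D) * f k \<in> \<int>" if "k \<in> insert a A" for k
  proof (cases "k = a")
    case True
    then have "of_int (n * D) * f k = of_int (D * m)" using mn by simp
    then show ?thesis by (metis Ints_of_int)
  next
    case False
    then have "of_int n * (of_int D * f k) \<in> \<int>" using that D Ints_mult[OF Ints_of_int] by blast
    then show ?thesis by (metis mult.assoc of_int_mult)
  qed
  then show ?case using D mn by (intro exI[of _ "n * D"]) auto
qed

text \<open>The powers of \<open>z\<close> take finitely many values, so a functional with
  \<open>\<phi> b = 1\<close> maps Z[z] into the rationals with one common denominator
  \<open>D\<close>. Applied to \<open>b = of_nat p * r\<close> it shows that \<open>p\<close>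
  divides \<open>D\<close>, which fails for \<open>p > D\<close>.\<close>

lemma int_adjoin_root_of_unity_divisibility:
  assumes z: "z ^ N = 1" "N > 0" and b: "b \<noteq> 0"
  shows "\<exists>A. \<forall>p>A. \<forall>r\<in>int_adjoin z. b \<noteq> of_nat p * r"
proof -
  obtain \<phi> :: "complex \<Rightarrow> rat" where \<phi>: "\<phi> b = 1" "\<And>x y. \<phi> (x + y) = \<phi> x + \<phi> y"
    "\<And>q x. \<phi> (of_rat q * x) = q * \<phi> x"
    using exists_rat_linear_functional[OF b] by blast
  have \<phi>0: "\<phi> 0 = 0" using \<phi>(3)[of 0 0] by simp
  obtain D :: int where D: "D > 0" "\<And>k. k < N \<Longrightarrow> of_int D * \<phi> (z ^ k) \<in> \<int>"
    using exists_common_denominator[of "{..<N}" "\<lambda>k. \<phi> (z ^ k)"] by auto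
  have mod: "z ^ k = z ^ (k mod N)" for k
    by (metis div_mult_mod_eq mult_1 power_add power_mult power_one z(1) mult.commute)
  have D': "of_int D * \<phi> (z ^ k) \<in> \<int>" for k
    using D(2)[of "k mod N"] z(2) mod[of k] by simp
  have sum: "\<phi> (sum f K) = (\<Sum>k\<in>K. \<phi> (f k))" for f :: "nat \<Rightarrow> complex" and K
    by (induction K rule: infinite_finite_induct) (auto simp: \<phi>0 \<phi>(2))
  have int: "of_int D * \<phi> r \<in> \<int>" if r: "r \<in> int_adjoin z" for r
  proof -
    obtain P where P: "r = poly P z" "\<forall>i. Polynomial.coeff P i \<in> \<int>"
      using r unfolding int_adjoin_def by blast
    have "of_int D * \<phi> (Polynomial.coeff P i * z ^ i) \<in> \<int>" for i
    proof -
      obtain m where m: "Polynomial.coeff P i = of_rat (of_int m)"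
        using P(2) by (metis Ints_cases of_rat_of_int_eq)
      have "of_int D * \<phi> (Polynomial.coeff P i * z ^ i) = of_int m * (of_int D * \<phi> (z ^ i))"
        unfolding m \<phi>(3) by simp
      then show ?thesis using D'[of i] by (metis Ints_mult Ints_of_int)
    qed
    then show ?thesis
      unfolding P(1) poly_altdef sum sum_distrib_left by (intro Ints_sum)
  qed
  have "b \<noteq> of_nat p * r" if p: "p > nat D" and r: "r \<in> int_adjoin z" for p r
  proof
    assume *: "b = of_nat p * r"
    obtain m where m: "of_int D * \<phi> r = of_int m"
      using int[OF r] by (auto elim: Ints_cases)
    have "1 = of_nat p * \<phi> r"
      using \<phi>(1) \<phi>(3)[of "of_nat p" r] * by simp
    then have "of_int D = of_nat p * (of_int D * \<phi> r)" by simp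
    also have "\<dots> = of_int (int p * m)" unfolding m by simp
    finally have "D = int p * m" by (simp only: of_int_eq_iff)
    then have "int p dvd D" by simp
    then show False using p D(1) zdvd_imp_le[of "int p" D] by linarith
  qed
  then show ?thesis by blast
qed

text \<open>Landau's proof that the primitive roots of unity are conjugate. An integer polynomial vanishing
  at \<open>\<zeta>\<close> takes at \<open>\<zeta> ^ p\<close> a value divisible by \<open>p\<close>; only finitely many values occur, so for large
  primes that value is zero, and every class prime to the order contains an \<open>m\<close> all of whose prime
  factors are large.\<close>

lemma int_poly_root_of_unity_conjugate:
  fixes z :: complex
  assumes z: "z ^ N = 1" "N > 0" and P: "\<forall>i. Polynomial.coeff P i \<in> \<int>" and root: "poly P z = 0"
    and a: "coprime a N"
  shows "poly P (z ^ a) = 0"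
proof -
  have mod: "z ^ k = z ^ (k mod N)" for k
    by (metis div_mult_mod_eq mult_1 power_add power_mult power_one z(1) mult.commute)
  have "\<exists>A. \<forall>p>A. \<forall>r\<in>int_adjoin z. poly P (z ^ k) \<noteq> 0 \<longrightarrow> poly P (z ^ k) \<noteq> of_nat p * r" for k
    using int_adjoin_root_of_unity_divisibility[OF z] by blast
  then obtain A where A: "\<And>k p r. p > A k \<Longrightarrow> r \<in> int_adjoin z \<Longrightarrow> poly P (z ^ k) \<noteq> 0
      \<Longrightarrow> poly P (z ^ k) \<noteq> of_nat p * r"
    by metis
  define B where "B = Max (A ` {..<N})"
  have B: "A (k mod N) \<le> B" for k
    unfolding B_def using z(2) by (intro Max_ge) auto
  have step: "poly P (z ^ (k * p)) = 0" if k: "poly P (z ^ k) = 0" and p: "prime p" "p > B" for k p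
  proof (rule ccontr)
    assume nz: "poly P (z ^ (k * p)) \<noteq> 0"
    obtain r where "r \<in> int_adjoin z" "poly P ((z ^ k) ^ p) = poly P (z ^ k) ^ p + of_nat p * r"
      using frobenius_int_poly[OF p(1) P, of "z ^ k" z] int_adjoin_power int_adjoin_self by blast
    then have "r \<in> int_adjoin z" "poly P (z ^ (k * p)) = of_nat p * r"
      using k p(1) by (simp_all add: power_mult prime_gt_0_nat zero_power)
    then show False
      using A[of "(k * p) mod N" p r] nz p(2) B[of "k * p"] mod[of "k * p"] by fastforce
  qed
  have large: "poly P (z ^ m) = 0" if "m > 0" "\<forall>q. prime q \<longrightarrow> q dvd m \<longrightarrow> q > B" for m
    using that
  proof (induction m rule: less_induct)
    case (less m)
    show ?case
    proof (cases "m = 1")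
      case True
      then show ?thesis using root by simp
    next
      case False
      then obtain q where q: "prime q" "q dvd m" by (metis prime_factor_nat)
      then obtain k where k: "m = k * q" by (metis dvdE mult.commute)
      have "k < m" "k > 0"
        using less.prems(1) k prime_gt_1_nat[OF q(1)] by auto
      moreover have "\<forall>r. prime r \<longrightarrow> r dvd k \<longrightarrow> r > B"
        using less.prems k by auto
      ultimately have "poly P (z ^ k) = 0" using less.IH by blast
      then show ?thesis using step[of k q] q less.prems k by blast
    qed
  qed
  \<comment> \<open>The shift \<open>N * \<Prod>S\<close> is chosen to exclude each prime
    \<open>q \<le> B\<close> from \<open>m\<close>: if \<open>q\<close> divides \<open>a\<close>, it
    divides neither \<open>N\<close> nor the product; otherwise it divides the product but not
    \<open>a\<close>.\<close>
  define S where "S = {q. prime q \<and> q \<le> B \<and> \<not> q dvd a}"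
  have finS: "finite S" unfolding S_def by (rule finite_subset[of _ "{..B}"]) auto
  define m where "m = a + N * \<Prod>S"
  have Spos: "\<Prod>S > 0"
    unfolding S_def by (intro prod_pos) (auto simp: prime_gt_0_nat)
  have "q > B" if q: "prime q" "q dvd m" for q
  proof (rule ccontr)
    assume "\<not> q > B"
    show False
    proof (cases "q dvd a")
      case True
      then have "q dvd N * \<Prod>S" using q(2) unfolding m_def by (simp add: dvd_add_right_iff)
      moreover have "\<not> q dvd N" using True a q(1) by (meson coprime_common_divisor not_prime_unit)
      ultimately have "q dvd \<Prod>S" using q(1) by (simp add: prime_dvd_mult_iff)
      then obtain q' where "q' \<in> S" "q dvd q'"
        using q(1) finS by (metis prime_dvd_prod_iff)
      then show False using True q(1) unfolding S_def by (auto dest: primes_dvd_imp_eq)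
    next
      case False
      then have "q \<in> S" using \<open>\<not> q > B\<close> q(1) unfolding S_def by auto
      then have "q dvd N * \<Prod>S" using finS by (auto intro: dvd_mult dvd_prodI)
      then show False using False q(2) unfolding m_def by (simp add: dvd_add_left_iff)
    qed
  qed
  then have "poly P (z ^ m) = 0"
    using large[of m] Spos z(2) unfolding m_def by auto
  moreover have "m mod N = a mod N" unfolding m_def by simp
  ultimately show ?thesis using mod[of m] mod[of a] by simp
qed

section \<open>Abel summation and Euler products\<close>

lemma sum_lessThan_add_nat:
  fixes f :: "nat \<Rightarrow> 'a :: comm_monoid_add"
  shows "(\<Sum>k<m + n. f k) = (\<Sum>k<m. f k) + (\<Sum>k<n. f (m + k))"
  by (induction n) (auto simp: add_ac)

lemma bij_betw_mult_mod:
  fixes a N :: nat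
  assumes "coprime a N" "N > 0"
  shows "bij_betw (\<lambda>k. a * k mod N) {..<N} {..<N}"
proof -
  have "inj_on (\<lambda>k. a * k mod N) {..<N}"
  proof (rule inj_onI)
    fix x y assume "x \<in> {..<N}" "y \<in> {..<N}" "a * x mod N = a * y mod N"
    then have "[x = y] (mod N)"
      using assms(1) by (metis cong_def cong_mult_lcancel_nat)
    then show "x = y" using \<open>x \<in> _\<close> \<open>y \<in> _\<close> by (simp add: cong_def)
  qed
  moreover have "(\<lambda>k. a * k mod N) ` {..<N} \<subseteq> {..<N}" using assms(2) by auto
  ultimately show ?thesis
    by (simp add: bij_betw_def endo_inj_surj)
qed

lemma norm_sum_mult_le_variation:
  fixes f :: "nat \<Rightarrow> complex" and g :: "nat \<Rightarrow> real"
  assumes B: "\<And>n. norm (\<Sum>k<n. f k) \<le> B"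
  shows "norm (\<Sum>k<n. f k * of_real (g k)) \<le> B * (\<bar>g n\<bar> + (\<Sum>k<n. \<bar>g k - g (Suc k)\<bar>))"
proof -
  define F where "F n = (\<Sum>k<n. f k)" for n
  have "(\<Sum>k<n. f k * of_real (g k))
      = F n * of_real (g n) + (\<Sum>k<n. F (Suc k) * of_real (g k - g (Suc k)))"
    by (induction n) (auto simp: F_def algebra_simps)
  also have "norm \<dots> \<le> norm (F n) * \<bar>g n\<bar> + (\<Sum>k<n. norm (F (Suc k)) * \<bar>g k - g (Suc k)\<bar>)"
    by (intro norm_triangle_le add_mono sum_norm_le) (auto simp: norm_mult simp flip: of_real_diff)
  also have "\<dots> \<le> B * \<bar>g n\<bar> + (\<Sum>k<n. B * \<bar>g k - g (Suc k)\<bar>)"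
    unfolding F_def using B by (intro add_mono sum_mono mult_right_mono abs_ge_zero)
  finally show ?thesis by (simp add: sum_distrib_left distrib_left)
qed

lemma norm_sum_mult_le_antimono:
  fixes f :: "nat \<Rightarrow> complex" and g :: "nat \<Rightarrow> real"
  assumes "\<And>n. norm (\<Sum>k<n. f k) \<le> B" "\<And>k. g (Suc k) \<le> g k" "\<And>k. 0 \<le> g k"
  shows "norm (\<Sum>k<n. f k * of_real (g k)) \<le> B * g 0"
proof -
  have "(\<Sum>k<n. \<bar>g k - g (Suc k)\<bar>) = (\<Sum>k<n. g k - g (Suc k))"
    using assms(2) by (intro sum.cong) auto
  then have "\<bar>g n\<bar> + (\<Sum>k<n. \<bar>g k - g (Suc k)\<bar>) = g 0"
    using assms(3)[of n] by (simp add: sum_lessThan_telescope')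
  then show ?thesis using norm_sum_mult_le_variation[of f B g n] assms(1) by simp
qed

section \<open>Series of powers and Euler products\<close>

lemma summable_Suc_powr: "s > 1 \<Longrightarrow> summable (\<lambda>n. real (Suc n) powr -s)"
  using summable_real_powr_iff[of "-s"] summable_Suc_iff[of "\<lambda>n. real n powr -s"] by simp

text \<open>The mean value theorem for \<open>x powr (1 - s)\<close> bounds the terms after the
  first by a telescoping sum, giving \<open>1 + 1 / (s - 1)\<close>. This is the simple pole that
  enters the 3-4-1 argument.\<close>

lemma suminf_Suc_powr_le:
  assumes s: "s > 1"
  shows "(\<Sum>n. real (Suc n) powr -s) \<le> s / (s - 1)"
proof -
  have step: "(s - 1) * (x + 1) powr -s \<le> x powr (1 - s) - (x + 1) powr (1 - s)" if x: "x \<ge> 1" for x :: real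
  proof -
    have "\<exists>\<xi>. x < \<xi> \<and> \<xi> < x + 1 \<and>
        (x + 1) powr (1 - s) - x powr (1 - s) = (x + 1 - x) * ((1 - s) * \<xi> powr (1 - s - 1))"
      using x by (intro MVT2) (auto intro!: derivative_eq_intros)
    then obtain \<xi> where \<xi>: "x < \<xi>" "\<xi> < x + 1"
        "(x + 1) powr (1 - s) - x powr (1 - s) = (1 - s) * \<xi> powr (-s)"
      by auto
    have "(x + 1) powr -s \<le> \<xi> powr -s" using \<xi> x s by (intro powr_mono2') auto
    then have "(s - 1) * (x + 1) powr -s \<le> (s - 1) * \<xi> powr -s"
      using s by (intro mult_left_mono) auto
    also have "\<dots> = x powr (1 - s) - (x + 1) powr (1 - s)" using \<xi>(3) by (simp add: algebra_simps)
    finally show ?thesis .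
  qed
  have bound: "(s - 1) * (\<Sum>k<n. real (Suc k) powr -s) \<le> s - real n powr (1 - s)" if "n \<ge> 1" for n
    using that
  proof (induction n rule: nat_induct_at_least)
    case base
    then show ?case by simp
  next
    case (Suc n)
    then show ?case using step[of "real n"] by (simp add: algebra_simps)
  qed
  have "(s - 1) * (\<Sum>k<n. real (Suc k) powr -s) \<le> s" for n
  proof (cases "n \<ge> 1")
    case True
    then show ?thesis using bound[OF True] powr_ge_zero[of "real n" "1 - s"] by linarith
  next
    case False
    then have "n = 0" by simp
    then show ?thesis using s by simp
  qed
  then have "(\<Sum>k<n. real (Suc k) powr -s) \<le> s / (s - 1)" for n
    using s by (simp add: field_simps)
  then show ?thesis
    using summable_Suc_powr[OF s] by (intro suminf_le_const) auto
qed

text \<open>Sieving by one prime at a time: the multiples of \<open>p\<close> in the current set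
  \<open>D\<close> are exactly \<open>p * D\<close>, and they carry the part \<open>a p\<close> of
  the sum, so removing them multiplies it by \<open>1 - a p\<close>.\<close>

lemma infsum_completely_multiplicative_coprime:
  fixes a :: "nat \<Rightarrow> complex"
  assumes mult: "\<And>m n. a (m * n) = a m * a n" and sm: "summable (\<lambda>n. norm (a n))"
    and "finite S" "\<forall>p\<in>S. prime p"
  shows "infsum a {n. \<forall>p\<in>S. \<not> p dvd n} = (\<Sum>n. a n) * (\<Prod>p\<in>S. 1 - a p)"
  using assms(3,4)
proof (induction S)
  case empty
  have "(a has_sum (\<Sum>n. a n)) UNIV"
    using sm by (intro norm_summable_imp_has_sum) (auto intro: summable_sums summable_norm_cancel)
  then show ?case by (simp add: infsumI)
next
  case (insert p S)
  define D where "D = {n. \<forall>p\<in>S. \<not> p dvd n}"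
  define D' where "D' = {n. \<forall>p\<in>insert p S. \<not> p dvd n}"
  have p: "prime p" "\<forall>q\<in>S. prime q" using insert.prems by auto
  have "q dvd p * m \<longleftrightarrow> q dvd m" if "q \<in> S" for q m
  proof -
    have "\<not> q dvd p" using that p insert.hyps(2) primes_dvd_imp_eq by blast
    then show ?thesis using that p by (simp add: prime_dvd_mult_iff)
  qed
  then have pD: "p * m \<in> D \<longleftrightarrow> m \<in> D" for m
    unfolding D_def by blast
  have D': "D' = D - {n. p dvd n}" unfolding D_def D'_def by blast
  have D: "D = D' \<union> (*) p ` D" "D' \<inter> (*) p ` D = {}"
    unfolding D' using pD by (auto elim!: dvdE)
  have sms: "a summable_on A" for A
    using norm_summable_imp_summable_on[OF sm] summable_on_subset_banach by blast
  have "infsum a D = infsum a D' + infsum a ((*) p ` D)"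
    by (subst D(1), rule infsum_Un_disjoint) (use D(2) sms in auto)
  also have "infsum a ((*) p ` D) = infsum (\<lambda>n. a (p * n)) D"
    using p prime_gt_0_nat by (subst infsum_reindex) (auto simp: inj_on_def o_def)
  also have "\<dots> = a p * infsum a D"
    unfolding mult by (rule infsum_cmult_right')
  finally have "infsum a D' = infsum a D * (1 - a p)"
    by (metis add_diff_cancel_right' mult.commute mult_1_right right_diff_distrib)
  then show ?case using insert.IH p insert.hyps unfolding D_def D'_def by simp
qed

text \<open>After sieving by all primes up to \<open>y\<close>, apart from 0 only 1 and numbers
  above \<open>y\<close> survive, so the error is a tail of an absolutely convergent series. This
  form needs neither inverses of the factors nor an infinite product.\<close>

lemma euler_product_tendsto_1:
  fixes a :: "nat \<Rightarrow> complex"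
  assumes mult: "\<And>m n. a (m * n) = a m * a n" and sm: "summable (\<lambda>n. norm (a n))"
    and a: "a 0 = 0" "a 1 = 1"
  shows "(\<lambda>y. (\<Sum>n. a n) * (\<Prod>p | prime p \<and> p \<le> y. 1 - a p)) \<longlonglongrightarrow> 1"
proof -
  let ?D = "\<lambda>y. {n. \<forall>p\<in>{p. prime p \<and> p \<le> y}. \<not> p dvd n}"
  have sms: "a summable_on A" "(\<lambda>n. norm (a n)) summable_on A" for A
    using norm_summable_imp_summable_on[OF sm] norm_summable_imp_summable_on[of "\<lambda>n. norm (a n)"] sm
      summable_on_subset_banach by auto
  have bnd: "norm ((\<Sum>n. a n) * (\<Prod>p | prime p \<and> p \<le> y. 1 - a p) - 1)
      \<le> (\<Sum>n. norm (a n)) - (\<Sum>n\<le>y. norm (a n))" for y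
  proof -
    have one: "1 \<in> ?D y" by auto
    have sub: "?D y - {1} - {0} \<subseteq> {y<..}"
    proof
      fix n assume n: "n \<in> ?D y - {1} - {0}"
      then have "n \<noteq> 1" by simp
      then obtain q where "prime q" "q dvd n" using prime_factor_nat by blast
      then have "q > y" using n by auto
      then show "n \<in> {y<..}" using \<open>q dvd n\<close> n by (auto dest: dvd_imp_le)
    qed
    have "(\<Sum>n. a n) * (\<Prod>p | prime p \<and> p \<le> y. 1 - a p) = infsum a (?D y)"
      using mult sm by (intro infsum_completely_multiplicative_coprime[symmetric]) auto
    also have "infsum a (?D y) = infsum a (insert 1 (?D y - {1} - {0}))"
      using a one by (intro infsum_cong_neutral) auto
    also have "\<dots> = 1 + infsum a (?D y - {1} - {0})"
      using a sms by (subst infsum_insert) auto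
    finally have "norm ((\<Sum>n. a n) * (\<Prod>p | prime p \<and> p \<le> y. 1 - a p) - 1)
        = norm (infsum a (?D y - {1} - {0}))" by simp
    also have "\<dots> \<le> infsum (\<lambda>n. norm (a n)) (?D y - {1} - {0})"
      using sms by (intro norm_infsum_bound)
    also have "\<dots> \<le> infsum (\<lambda>n. norm (a n)) {y<..}"
      using sms sub by (intro infsum_mono2) auto
    also have "\<dots> = infsum (\<lambda>n. norm (a n)) UNIV - (\<Sum>n\<le>y. norm (a n))"
    proof -
      have "UNIV = {..y} \<union> {y<..}" by auto
      moreover have "infsum (\<lambda>n. norm (a n)) ({..y} \<union> {y<..})
          = infsum (\<lambda>n. norm (a n)) {..y} + infsum (\<lambda>n. norm (a n)) {y<..}"
        using sms by (intro infsum_Un_disjoint) auto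
      ultimately have "infsum (\<lambda>n. norm (a n)) UNIV
          = infsum (\<lambda>n. norm (a n)) {..y} + infsum (\<lambda>n. norm (a n)) {y<..}" by metis
      then show ?thesis by simp
    qed
    also have "infsum (\<lambda>n. norm (a n)) UNIV = (\<Sum>n. norm (a n))"
      using sm by (intro infsumI norm_summable_imp_has_sum) (auto intro: summable_sums)
    finally show ?thesis .
  qed
  have "(\<lambda>y. (\<Sum>n. norm (a n)) - (\<Sum>n\<le>y. norm (a n))) \<longlonglongrightarrow> (\<Sum>n. norm (a n)) - (\<Sum>n. norm (a n))"
    by (intro tendsto_diff tendsto_const summable_LIMSEQ' sm)
  then have lim: "(\<lambda>y. (\<Sum>n. norm (a n)) - (\<Sum>n\<le>y. norm (a n))) \<longlonglongrightarrow> 0"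
    by (simp only: diff_self)
  have "(\<lambda>y. (\<Sum>n. a n) * (\<Prod>p | prime p \<and> p \<le> y. 1 - a p) - 1) \<longlonglongrightarrow> 0"
    by (rule Lim_null_comparison[OF always_eventually[OF allI[OF bnd]] lim])
  then show ?thesis by (rule LIM_zero_cancel)
qed

text \<open>The logarithm of the left-hand side is \<open>- (\<Sum>k. x ^ k / k * Re (3 + 4 * w ^ k + w ^ (2 * k)))\<close>, and
  \<open>3 + 4 * cos \<theta> + cos (2 * \<theta>) = 2 * (1 + cos \<theta>)\<^sup>2\<close>.\<close>

lemma norm_three_four_one_le:
  fixes w :: complex and x :: real
  assumes x: "0 \<le> x" "x < 1" and w: "norm w = 1"
  shows "norm ((1 - of_real x) ^ 3 * (1 - w * of_real x) ^ 4 * (1 - w\<^sup>2 * of_real x)) \<le> 1"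
proof -
  have ser: "(\<lambda>n. - Re ((v * of_real x) ^ n) / real n) sums ln (norm (1 - v * of_real x))"
    "norm (1 - v * of_real x) > 0" if v: "norm v = 1" for v
  proof -
    have "norm (v * of_real x) < 1" using v x by (simp add: norm_mult)
    then have nz: "1 - v * of_real x \<noteq> 0" by (metis eq_iff_diff_eq_0 norm_one order_less_irrefl)
    show "norm (1 - v * of_real x) > 0" using nz by simp
    \<comment> \<open>The series starts at \<open>n = 0\<close>, where the division by zero makes
      the term 0.\<close>
    have "(\<lambda>n. - ((- (- (v * of_real x))) ^ n) / of_nat n) sums ln (1 + - (v * of_real x))"
      using \<open>norm (v * of_real x) < 1\<close> by (intro Ln_series') simp
    then have "(\<lambda>n. Re (- ((v * of_real x) ^ n) / of_nat n)) sums Re (ln (1 - v * of_real x))"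
      using sums_Re by fastforce
    then show "(\<lambda>n. - Re ((v * of_real x) ^ n) / real n) sums ln (norm (1 - v * of_real x))"
      using nz by simp
  qed
  have w2: "norm (w\<^sup>2) = 1" using w by (simp add: norm_power)
  define t where "t n = 3 * (- Re ((1 * of_real x) ^ n) / real n)
      + 4 * (- Re ((w * of_real x) ^ n) / real n) + (- Re ((w\<^sup>2 * of_real x) ^ n) / real n)" for n
  have "t sums (3 * ln (norm (1 - 1 * of_real x :: complex)) + 4 * ln (norm (1 - w * of_real x))
      + ln (norm (1 - w\<^sup>2 * of_real x)))"
    unfolding t_def using ser(1)[of 1] ser(1)[OF w] ser(1)[OF w2]
    by (intro sums_add sums_mult) auto
  moreover have "t n \<le> 0" for n
  proof -
    define v where "v = w ^ n"
    have v: "(Re v)\<^sup>2 + (Im v)\<^sup>2 = 1"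
      using w by (simp add: v_def flip: cmod_power2) (simp add: norm_power)
    have "Re (v\<^sup>2) = 2 * (Re v)\<^sup>2 - 1"
      using v by (simp add: power2_eq_square)
    then have "3 + 4 * Re v + Re (v\<^sup>2) = 2 * (1 + Re v)\<^sup>2"
      by (simp add: power2_eq_square algebra_simps)
    then have "3 + 4 * Re v + Re (v\<^sup>2) \<ge> 0" by simp
    moreover have "t n = - (x ^ n * (3 + 4 * Re v + Re (v\<^sup>2))) / real n"
    proof -
      have "(w\<^sup>2) ^ n = v\<^sup>2" by (simp add: v_def flip: power_mult) (simp add: mult.commute)
      then have eqs: "(w\<^sup>2 * of_real x) ^ n = v\<^sup>2 * of_real (x ^ n)" "(w * of_real x) ^ n = v * of_real (x ^ n)"
        "(1 * of_real x) ^ n = (of_real (x ^ n) :: complex)"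
        by (simp_all add: v_def power_mult_distrib)
      show ?thesis
        unfolding t_def eqs times_complex.sel Re_complex_of_real Im_complex_of_real
        by (simp add: add_divide_distrib diff_divide_distrib algebra_simps)
    qed
    ultimately show ?thesis using x by (simp add: divide_nonpos_nonneg)
  qed
  ultimately have "3 * ln (norm (1 - of_real x :: complex)) + 4 * ln (norm (1 - w * of_real x))
      + ln (norm (1 - w\<^sup>2 * of_real x)) \<le> 0"
    using sums_le[of t "\<lambda>_. 0" _ 0] by simp
  then have "ln (norm (1 - of_real x :: complex) ^ 3 * norm (1 - w * of_real x) ^ 4 * norm (1 - w\<^sup>2 * of_real x)) \<le> 0"
    using ser(2)[of 1] ser(2)[OF w] ser(2)[OF w2] by (simp add: ln_mult ln_realpow)
  moreover have "norm (1 - of_real x :: complex) ^ 3 * norm (1 - w * of_real x) ^ 4 * norm (1 - w\<^sup>2 * of_real x) > 0"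
    using ser(2)[of 1] ser(2)[OF w] ser(2)[OF w2] by simp
  ultimately show ?thesis by (simp add: norm_mult norm_power)
qed

section \<open>Lambert series of real characters\<close>

text \<open>The arithmetic-geometric inequality for the pair of terms with indices \<open>i\<close>
  and \<open>n - 1 - i\<close>, whose product does not depend on \<open>i\<close>.\<close>

lemma sum_powers_ge:
  fixes u :: real
  assumes u: "0 \<le> u"
  shows "real n * u ^ (n - 1) \<le> (\<Sum>i<n. (u\<^sup>2) ^ i)"
proof -
  have "(\<Sum>i<n. 2 * u ^ (n - 1)) \<le> (\<Sum>i<n. (u\<^sup>2) ^ i + (u\<^sup>2) ^ (n - Suc i))"
  proof (intro sum_mono)
    fix i assume "i \<in> {..<n}"
    then have "u ^ (n - 1) = u ^ i * u ^ (n - Suc i)" by (simp flip: power_add)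
    moreover have "(u\<^sup>2) ^ j = (u ^ j)\<^sup>2" for j by (simp flip: power_mult add: mult.commute)
    ultimately show "2 * u ^ (n - 1) \<le> (u\<^sup>2) ^ i + (u\<^sup>2) ^ (n - Suc i)"
      using sum_squares_bound[of "u ^ i" "u ^ (n - Suc i)"] by (simp add: mult.assoc)
  qed
  also have "\<dots> = 2 * (\<Sum>i<n. (u\<^sup>2) ^ i)"
    using sum.nat_diff_reindex[of "\<lambda>i. (u\<^sup>2) ^ i" n] by (simp add: sum.distrib)
  finally show ?thesis by (simp add: mult.assoc)
qed

text \<open>The Lambert coefficient \<open>t ^ n / (1 - t ^ n)\<close> subtracted from its pole part
  \<open>1 / (n * (1 - t))\<close>. Summed against a character with vanishing L(1), the pole part
  contributes 0, and the remaining weights decrease from the value 1 at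
  \<open>n = 1\<close>.\<close>

definition lambert_weight :: "real \<Rightarrow> nat \<Rightarrow> real" where
  "lambert_weight t n = 1 / (real n * (1 - t)) - t ^ n / (1 - t ^ n)"

lemma lambert_weight_altdef:
  assumes "0 < t" "t < 1" "n > 0"
  shows "(1 - t) * lambert_weight t n = 1 / real n - t ^ n / (\<Sum>i<n. t ^ i)"
proof -
  have "1 - t ^ n = (1 - t) * (\<Sum>i<n. t ^ i)"
    using assms by (simp add: one_diff_power_eq)
  then have "lambert_weight t n = 1 / (real n * (1 - t)) - t ^ n / ((1 - t) * (\<Sum>i<n. t ^ i))"
    unfolding lambert_weight_def by simp
  moreover have "(\<Sum>i<n. t ^ i) > 0" using assms by (intro sum_pos) auto
  moreover have "q * (1 / (x * q) - T / (q * y)) = 1 / x - T / y" if "q > 0" "x > 0" "y > 0"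
    for q x y T :: real using that by (simp add: field_simps)
  ultimately show ?thesis using assms by simp
qed

lemma lambert_weight_nonneg:
  assumes t: "0 < t" "t < 1" and n: "n > 0"
  shows "0 \<le> lambert_weight t n"
proof -
  have "real n * t ^ n \<le> (\<Sum>i<n. t ^ i)"
    using sum_mono[of "{..<n}" "\<lambda>_. t ^ n" "\<lambda>i. t ^ i"] t by (simp add: power_decreasing)
  moreover have "(\<Sum>i<n. t ^ i) > 0" using t n by (intro sum_pos) auto
  ultimately have "0 \<le> (1 - t) * lambert_weight t n"
    using t n by (subst lambert_weight_altdef) (auto simp: field_simps)
  then show ?thesis using t by (simp add: zero_le_mult_iff)
qed

text \<open>Multiply the decrement by \<open>1 - t\<close>. With the geometric sums \<open>S\<close>
  and \<open>S'\<close> of lengths \<open>n\<close> and \<open>n + 1\<close>, the identity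
  \<open>S' - t * S = 1\<close> collapses it to \<open>1 / (n * (n + 1)) - t ^ n / (S * S')\<close>.
  Its sign follows from \<open>S \<ge> n * u ^ n\<close> and
  \<open>S' \<ge> (n + 1) * u ^ n\<close>, where \<open>u = sqrt t\<close>.\<close>

lemma lambert_weight_antimono:
  assumes t: "0 < t" "t < 1" and n: "n > 0"
  shows "lambert_weight t (Suc n) \<le> lambert_weight t n"
proof -
  define S where "S = (\<Sum>i<n. t ^ i)"
  define S' where "S' = (\<Sum>i<Suc n. t ^ i)"
  have S: "S > 0" unfolding S_def using t n by (intro sum_pos) auto
  have S'S: "S' = S + t ^ n" by (simp add: S_def S'_def)
  have "1 - t ^ n = (1 - t) * S"
    unfolding S_def using t by (simp add: one_diff_power_eq)
  then have one: "S' - t * S = 1" unfolding S'S by (simp add: algebra_simps)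
  have S': "S' > 0" using S S'S t by (simp add: add_pos_pos)
  define u where "u = sqrt t"
  have u: "0 < u" "u < 1" "t = u\<^sup>2" using t by (auto simp: u_def)
  have "real n * u ^ n \<le> real n * u ^ (n - 1)"
    using u by (intro mult_left_mono power_decreasing) auto
  then have "real n * u ^ n \<le> S"
    using sum_powers_ge[of u n] u unfolding S_def by simp
  moreover have "real (Suc n) * u ^ n \<le> S'"
    using sum_powers_ge[of u "Suc n"] u unfolding S'_def by simp
  ultimately have "(real n * u ^ n) * (real (Suc n) * u ^ n) \<le> S * S'"
    using u S by (intro mult_mono) auto
  also have "(real n * u ^ n) * (real (Suc n) * u ^ n) = real n * real (Suc n) * t ^ n"
    unfolding u(3) by (simp add: power2_eq_square power_mult_distrib)
  finally have key: "real n * real (Suc n) * t ^ n \<le> S * S'" .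
  have "T / B \<le> 1 / c" if "c * T \<le> B" "B > 0" "c > 0" for T B c :: real
    using that by (simp add: field_simps)
  from this[OF key] have "t ^ n / (S * S') \<le> 1 / (real n * real (Suc n))"
    using S S' n by simp
  also have "t ^ n / (S * S') = t ^ n / S - t ^ Suc n / S'"
  proof -
    have "t ^ n / S - t ^ Suc n / S' = t ^ n * (S' - t * S) / (S * S')"
      using S S' by (simp add: field_simps)
    then show ?thesis using one by simp
  qed
  also have "1 / (real n * real (Suc n)) = 1 / real n - 1 / real (Suc n)"
    using n by (simp add: field_simps)
  finally have "(1 - t) * lambert_weight t (Suc n) \<le> (1 - t) * lambert_weight t n"
    using t n lambert_weight_altdef[of t n] lambert_weight_altdef[of t "Suc n"] unfolding S_def S'_def by simp
  then show ?thesis using t by simp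
qed

section \<open>Divisor sums of real characters and the Lambert series\<close>

lemma divisor_sum_prime_power_mult:
  fixes r :: "nat \<Rightarrow> real"
  assumes mult: "\<And>m n. r (m * n) = r m * r n" and one: "r 1 = 1"
    and p: "prime p" and k: "\<not> p dvd k"
  shows "(\<Sum>d | d dvd p ^ e * k. r d) = (\<Sum>i\<le>e. r p ^ i) * (\<Sum>d | d dvd k. r d)"
proof -
  have "k > 0" using k by (cases k) auto
  have pow: "r (p ^ i) = r p ^ i" for i by (induction i) (auto simp: mult one[simplified])
  have "(\<Sum>d | d dvd p ^ e * k. r d) = (\<Sum>(i, d)\<in>{..e} \<times> {d. d dvd k}. r (p ^ i * d))"
  proof (rule sum.reindex_bij_witness[of _ "\<lambda>(i, d). p ^ i * d" "\<lambda>d. (multiplicity p d, d div p ^ multiplicity p d)"])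
    fix d assume d: "d \<in> {d. d dvd p ^ e * k}"
    then have d0: "d \<noteq> 0" using \<open>k > 0\<close> p by (auto intro!: Nat.gr0I dest: prime_gt_0_nat)
    have "multiplicity p (p ^ e * k) = e"
      using k p \<open>k > 0\<close> by (subst prime_elem_multiplicity_mult_distrib) (auto simp: not_dvd_imp_multiplicity_0)
    then have "multiplicity p d \<le> e"
      using d p \<open>k > 0\<close> by (metis dvd_imp_multiplicity_le mem_Collect_eq mult_is_0 not_gr_zero power_not_zero prime_gt_0_nat)
    moreover have "d div p ^ multiplicity p d dvd k"
    proof -
      have "\<not> p dvd d div p ^ multiplicity p d"
        using d0 p by (intro multiplicity_decompose) auto
      then have "coprime (d div p ^ multiplicity p d) (p ^ e)"
        using p by (metis coprime_commute coprime_power_left_iff prime_imp_coprime)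
      moreover have "d div p ^ multiplicity p d dvd p ^ e * k"
        using d by (metis dvd_trans mem_Collect_eq multiplicity_dvd dvd_div_mult_self dvd_triv_left)
      ultimately show ?thesis by (simp add: coprime_dvd_mult_right_iff)
    qed
    ultimately show "(multiplicity p d, d div p ^ multiplicity p d) \<in> {..e} \<times> {d. d dvd k}" by simp
  next
    fix x assume x: "x \<in> {..e} \<times> {d. d dvd k}"
    then obtain i d where id: "x = (i, d)" "i \<le> e" "d dvd k" by auto
    have "\<not> p dvd d" using id k dvd_trans by blast
    then have "multiplicity p (p ^ i * d) = i"
      using p by (metis \<open>0 < k\<close> dvd_0_left id(3) mult_eq_0_iff multiplicity_prime_elem_times_other
          neq0_conv not_dvd_imp_multiplicity_0 plus_nat.add_0 add.right_neutral power_eq_0_iff prime_def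
          prime_elem_multiplicity_mult_distrib multiplicity_same_power not_prime_0 not_prime_unit)
    then show "(\<lambda>d. (multiplicity p d, d div p ^ multiplicity p d)) (case x of (i, d) \<Rightarrow> p ^ i * d) = x"
      using p id by (auto dest: prime_gt_0_nat)
    show "(case x of (i, d) \<Rightarrow> p ^ i * d) \<in> {d. d dvd p ^ e * k}"
      using id by (auto intro!: mult_dvd_mono le_imp_power_dvd)
  qed (auto simp: multiplicity_dvd)
  also have "\<dots> = (\<Sum>i\<le>e. r p ^ i) * (\<Sum>d | d dvd k. r d)"
    by (simp add: sum_product sum.cartesian_product mult pow)
  finally show ?thesis .
qed

lemma geometric_sum_sign:
  fixes x :: real
  assumes "x \<in> {0, 1, -1}"
  shows "0 \<le> (\<Sum>i\<le>e. x ^ i)" "even e \<Longrightarrow> 1 \<le> (\<Sum>i\<le>e. x ^ i)"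
proof -
  have "(\<Sum>i\<le>e. (-1 :: real) ^ i) = (if even e then 1 else 0)"
    by (induction e) auto
  moreover have "(\<Sum>i\<le>e. (0::real) ^ i) = 1"
    by (induction e) auto
  ultimately show "0 \<le> (\<Sum>i\<le>e. x ^ i)" "even e \<Longrightarrow> 1 \<le> (\<Sum>i\<le>e. x ^ i)"
    using assms by auto
qed

text \<open>Splitting off the full power of a prime leaves a geometric sum in \<open>r p\<close> as
  local factor; for \<open>r p = -1\<close> it alternates between 1 and 0, and otherwise it is
  positive.\<close>

lemma divisor_sum_nonneg:
  fixes r :: "nat \<Rightarrow> real"
  assumes mult: "\<And>m n. r (m * n) = r m * r n" and one: "r 1 = 1" and vals: "\<And>n. r n \<in> {0, 1, -1}"
    and "m > 0"
  shows "0 \<le> (\<Sum>d | d dvd m. r d)"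
  using \<open>m > 0\<close>
proof (induction m rule: less_induct)
  case (less m)
  show ?case
  proof (cases "m = 1")
    case True
    then show ?thesis using one by simp
  next
    case False
    then obtain p where p: "prime p" "p dvd m" by (metis prime_factor_nat)
    obtain k where k: "m = p ^ multiplicity p m * k" "\<not> p dvd k"
      using multiplicity_decompose'[of m p] less.prems p(1) not_prime_unit by blast
    have "k > 0" using k(2) by (cases k) auto
    have "k < m"
    proof (rule ccontr)
      assume "\<not> k < m"
      then have "m = k" using k(1) less.prems by (metis dvd_imp_le dvd_triv_right le_neq_implies_less)
      then show False using k(2) p(2) by simp
    qed
    then have "0 \<le> (\<Sum>d | d dvd k. r d)" using less.IH \<open>k > 0\<close> by blast
    moreover have "(\<Sum>d | d dvd m. r d) = (\<Sum>i\<le>multiplicity p m. r p ^ i) * (\<Sum>d | d dvd k. r d)"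
      by (subst k(1)) (rule divisor_sum_prime_power_mult[OF mult one p(1) k(2)])
    ultimately show ?thesis using geometric_sum_sign(1)[OF vals] by simp
  qed
qed

text \<open>In a square all exponents are even, so the alternating local factor always ends at
  1.\<close>

lemma divisor_sum_square_ge_1:
  fixes r :: "nat \<Rightarrow> real"
  assumes mult: "\<And>m n. r (m * n) = r m * r n" and one: "r 1 = 1" and vals: "\<And>n. r n \<in> {0, 1, -1}"
    and "m > 0"
  shows "1 \<le> (\<Sum>d | d dvd m\<^sup>2. r d)"
  using \<open>m > 0\<close>
proof (induction m rule: less_induct)
  case (less m)
  show ?case
  proof (cases "m = 1")
    case True
    then show ?thesis using one by simp
  next
    case False
    then obtain p where p: "prime p" "p dvd m" by (metis prime_factor_nat)
    obtain k where k: "m = p ^ multiplicity p m * k" "\<not> p dvd k"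
      using multiplicity_decompose'[of m p] less.prems p(1) not_prime_unit by blast
    have "k > 0" using k(2) by (cases k) auto
    have "k < m"
    proof (rule ccontr)
      assume "\<not> k < m"
      then have "m = k" using k(1) less.prems by (metis dvd_imp_le dvd_triv_right le_neq_implies_less)
      then show False using k(2) p(2) by simp
    qed
    then have IH: "1 \<le> (\<Sum>d | d dvd k\<^sup>2. r d)" using less.IH \<open>k > 0\<close> by blast
    have sq: "m\<^sup>2 = p ^ (2 * multiplicity p m) * k\<^sup>2"
      by (subst k(1)) (simp add: power_mult_distrib power_mult mult.commute flip: power_mult)
    have "(\<Sum>d | d dvd m\<^sup>2. r d) = (\<Sum>i\<le>2 * multiplicity p m. r p ^ i) * (\<Sum>d | d dvd k\<^sup>2. r d)"
      unfolding sq using p(1) k(2)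
      by (intro divisor_sum_prime_power_mult[OF mult one p(1)]) (simp add: prime_dvd_power_iff)
    moreover have "1 * 1 \<le> (\<Sum>i\<le>2 * multiplicity p m. r p ^ i) * (\<Sum>d | d dvd k\<^sup>2. r d)"
      using IH geometric_sum_sign[OF vals] by (intro mult_mono) auto
    ultimately show ?thesis by simp
  qed
qed

text \<open>Expand each \<open>t ^ n / (1 - t ^ n)\<close> geometrically and regroup the double
  series by the product of the two indices. Absolute convergence comes from
  \<open>t ^ (Suc n * Suc k) \<le> t ^ n * t ^ k\<close>.\<close>

lemma lambert_series_has_sum:
  fixes r :: "nat \<Rightarrow> real"
  assumes t: "0 < t" "t < 1" and r: "\<And>n. \<bar>r n\<bar> \<le> 1"
  obtains S where "(\<lambda>n. r (Suc n) * (t ^ Suc n / (1 - t ^ Suc n))) sums S"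
    "((\<lambda>m. (\<Sum>d | d dvd m. r d) * t ^ m) has_sum S) {0<..}"
proof -
  define f where "f = (\<lambda>(n, k). r (Suc n) * t ^ (Suc n * Suc k))"
  have geo: "((\<lambda>k. t ^ k) has_sum (1 / (1 - t))) UNIV"
    using t by (intro sums_nonneg_imp_has_sum geometric_sums) auto
  have "Infinite_Sum.abs_summable_on (\<lambda>(n, k). t ^ n * t ^ k) (UNIV \<times> UNIV)"
  proof (subst Infinite_Sum.abs_summable_on_Sigma_iff, intro conjI ballI)
    fix n :: nat
    show "Infinite_Sum.abs_summable_on (\<lambda>k. case (n, k) of (n, k) \<Rightarrow> t ^ n * t ^ k) UNIV"
      using t has_sum_imp_summable[OF geo] by (simp add: summable_on_cmult_right)
  next
    have "infsum (\<lambda>k. norm (t ^ n * t ^ k)) UNIV = 1 / (1 - t) * t ^ n" for n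
      using t has_sum_cmult_right[OF geo, of "t ^ n"] by (simp add: infsumI)
    then show "Infinite_Sum.abs_summable_on (\<lambda>n. infsum (\<lambda>k. norm (case (n, k) of (n, k) \<Rightarrow> t ^ n * t ^ k)) UNIV) UNIV"
      using t summable_on_cmult_right[OF has_sum_imp_summable[OF geo], of "1 / (1 - t)"] by simp
  qed
  then have "Infinite_Sum.abs_summable_on f (UNIV \<times> UNIV)"
  proof (rule Infinite_Sum.abs_summable_on_comparison_test)
    fix x :: "nat \<times> nat"
    obtain n k where x: "x = (n, k)" by (cases x)
    have "t ^ (Suc n * Suc k) \<le> t ^ (n + k)"
      using t by (intro power_decreasing) auto
    then have "\<bar>r (Suc n)\<bar> * t ^ (Suc n * Suc k) \<le> 1 * t ^ (n + k)"
      using t r by (intro mult_mono) auto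
    then show "norm (f x) \<le> norm (case x of (n, k) \<Rightarrow> t ^ n * t ^ k)"
      using t by (simp add: x f_def abs_mult power_add)
  qed
  then have "f summable_on UNIV \<times> UNIV" by (rule abs_summable_summable)
  then obtain S where S: "(f has_sum S) (UNIV \<times> UNIV)" by (auto simp: summable_on_def)
  have "((\<lambda>n. r (Suc n) * (t ^ Suc n / (1 - t ^ Suc n))) has_sum S) UNIV"
  proof (rule has_sum_SigmaD[OF S])
    fix n
    have q: "0 \<le> t ^ Suc n" "t ^ Suc n < 1" using t power_Suc_less_one by auto
    have "(\<lambda>k. (t ^ Suc n) ^ k) sums (1 / (1 - t ^ Suc n))"
      using q by (intro geometric_sums) simp
    then have "(\<lambda>k. t ^ Suc n * (t ^ Suc n) ^ k) sums (t ^ Suc n * (1 / (1 - t ^ Suc n)))"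
      by (rule sums_mult)
    then have "((\<lambda>k. (t ^ Suc n) ^ Suc k) has_sum (t ^ Suc n / (1 - t ^ Suc n))) UNIV"
      using t by (intro sums_nonneg_imp_has_sum) auto
    then have "((\<lambda>k. r (Suc n) * (t ^ Suc n) ^ Suc k) has_sum (r (Suc n) * (t ^ Suc n / (1 - t ^ Suc n)))) UNIV"
      by (rule has_sum_cmult_right)
    moreover have "f (n, k) = r (Suc n) * (t ^ Suc n) ^ Suc k" for k
      unfolding f_def prod.case by (subst power_mult) (rule refl)
    ultimately show "((\<lambda>k. f (n, k)) has_sum (r (Suc n) * (t ^ Suc n / (1 - t ^ Suc n)))) UNIV"
      by presburger
  qed
  then have 1: "(\<lambda>n. r (Suc n) * (t ^ Suc n / (1 - t ^ Suc n))) sums S"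
    by (rule has_sum_imp_sums)
  let ?D = "Sigma {0::nat<..} (\<lambda>m. {d. d dvd m})"
  have bij: "bij_betw (\<lambda>(n, k). (Suc n * Suc k, Suc n)) (UNIV \<times> UNIV) ?D"
  proof (rule bij_betw_byWitness[where f' = "\<lambda>(m, d). (d - 1, m div d - 1)"])
    show "\<forall>x\<in>?D. (case (case x of (m, d) \<Rightarrow> (d - 1, m div d - 1)) of (n, k) \<Rightarrow> (Suc n * Suc k, Suc n)) = x"
    proof
      fix x assume "x \<in> ?D"
      then obtain d k where dk: "x = (d * k, d)" "d > 0" "k > 0" by (auto elim!: dvdE)
      then obtain i j where "d = Suc i" "k = Suc j" by (metis gr0_implies_Suc)
      then have x: "x = (Suc i * Suc j, Suc i)" using dk by simp
      then show "(case (case x of (m, d) \<Rightarrow> (d - 1, m div d - 1)) of (n, k) \<Rightarrow> (Suc n * Suc k, Suc n)) = x"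
        unfolding x prod.case by (simp only: diff_Suc_1 nonzero_mult_div_cancel_left nat.simps not_False_eq_True)
    qed
  qed (auto simp del: mult_Suc mult_Suc_right)
  have "((\<lambda>(m, d). r d * t ^ m) has_sum S) ?D"
    using S has_sum_reindex_bij_betw[OF bij, of "\<lambda>(m, d). r d * t ^ m" S]
    unfolding f_def by (simp add: case_prod_unfold)
  then have "((\<lambda>m. (\<Sum>d | d dvd m. r d) * t ^ m) has_sum S) {0<..}"
  proof (rule has_sum_SigmaD)
    fix m :: nat assume "m \<in> {0<..}"
    then have "finite {d. d dvd m}" by simp
    then show "((\<lambda>d. case (m, d) of (m, d) \<Rightarrow> r d * t ^ m) has_sum (\<Sum>d | d dvd m. r d) * t ^ m) {d. d dvd m}"
      by (auto simp: sum_distrib_right intro!: has_sum_finiteI)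
  qed
  with 1 show ?thesis by (rule that)
qed

text \<open>Keep only the exponents that are squares of \<open>1\<close>, ..., \<open>M\<close>:
  each has coefficient at least 1 and power at least \<open>t ^ (M\<^sup>2)\<close>, and all dropped
  terms are nonnegative.\<close>

lemma lambert_series_ge:
  fixes r :: "nat \<Rightarrow> real"
  assumes t: "0 < t" "t < 1"
    and mult: "\<And>m n. r (m * n) = r m * r n" and one: "r 1 = 1" and vals: "\<And>n. r n \<in> {0, 1, -1}"
    and S: "(\<lambda>n. r (Suc n) * (t ^ Suc n / (1 - t ^ Suc n))) sums S"
  shows "real M * t ^ (M\<^sup>2) \<le> S"
proof -
  have "\<bar>r n\<bar> \<le> 1" for n using vals[of n] by auto
  then obtain S' where S': "(\<lambda>n. r (Suc n) * (t ^ Suc n / (1 - t ^ Suc n))) sums S'"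
    "((\<lambda>m. (\<Sum>d | d dvd m. r d) * t ^ m) has_sum S') {0<..}"
    using lambert_series_has_sum[OF t, of r] by blast
  have "S' = S" using S S'(1) sums_unique2 by blast
  have "(\<Sum>m\<in>{1..M}. t ^ (M\<^sup>2)) \<le> (\<Sum>m\<in>{1..M}. (\<Sum>d | d dvd m\<^sup>2. r d) * t ^ (m\<^sup>2))"
  proof (intro sum_mono)
    fix m assume m: "m \<in> {1..M}"
    have "1 * t ^ (M\<^sup>2) \<le> (\<Sum>d | d dvd m\<^sup>2. r d) * t ^ (m\<^sup>2)"
      using m t divisor_sum_square_ge_1[OF mult one vals, of m]
      by (intro mult_mono power_decreasing) (auto intro: power_mono)
    then show "t ^ (M\<^sup>2) \<le> (\<Sum>d | d dvd m\<^sup>2. r d) * t ^ (m\<^sup>2)" by simp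
  qed
  also have "\<dots> = (\<Sum>m\<in>(\<lambda>m. m\<^sup>2) ` {1..M}. (\<Sum>d | d dvd m. r d) * t ^ m)"
    by (subst sum.reindex) (auto simp: inj_on_def)
  also have "\<dots> \<le> S'"
    using t divisor_sum_nonneg[OF mult one vals]
    by (intro finite_sum_le_has_sum[OF S'(2)]) auto
  finally show ?thesis using \<open>S' = S\<close> by simp
qed

section \<open>Nonvanishing of Dirichlet series at 1\<close>

text \<open>Characters are functions on the naturals that vanish off the units. Imprimitive and
  principal ones are included, since the 3-4-1 argument also applies the locale to the square and to
  the absolute value of \<psi>.\<close>

locale dirichlet_character =
  fixes N :: nat and \<psi> :: "nat \<Rightarrow> complex"
  assumes N: "N > 1"
    and periodic: "\<psi> (n mod N) = \<psi> n"
    and mult: "\<psi> (m * n) = \<psi> m * \<psi> n"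
    and one: "\<psi> 1 = 1"
    and eq_0: "\<not> coprime n N \<Longrightarrow> \<psi> n = 0"
begin

lemma zero: "\<psi> 0 = 0"
  using N by (intro eq_0) auto

lemma power: "\<psi> (n ^ k) = \<psi> n ^ k"
  using one by (induction k) (auto simp: mult)

lemma norm_coprime: "coprime n N \<Longrightarrow> norm (\<psi> n) = 1"
proof -
  assume "coprime n N"
  then have "[n ^ totient N = 1] (mod N)" by (rule euler_theorem)
  then have "\<psi> (n ^ totient N) = \<psi> 1" by (metis cong_def periodic)
  then have "norm (\<psi> n) ^ totient N = 1" using one by (simp add: power flip: norm_power)
  moreover have "totient N > 0" using N by simp
  ultimately show ?thesis by (metis norm_ge_zero power_eq_1_iff norm_one abs_norm_cancel real_norm_def not_gr_zero)
qed

lemma norm_le_1: "norm (\<psi> n) \<le> 1"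
  using norm_coprime[of n] eq_0[of n] by (cases "coprime n N") auto

lemma square_character: "dirichlet_character N (\<lambda>n. (\<psi> n)\<^sup>2)"
  using N one eq_0 by unfold_locales (auto simp: periodic mult power_mult_distrib)

text \<open>Multiplication by \<open>a\<close> permutes the residues and scales the sum by
  \<open>\<psi> a\<close>. Here and below such an \<open>a\<close> is the witness that the character
  is not principal.\<close>

lemma sum_period:
  assumes a: "coprime a N" "\<psi> a \<noteq> 1"
  shows "(\<Sum>k<N. \<psi> k) = 0"
proof -
  have "(\<Sum>k<N. \<psi> k) = (\<Sum>k<N. \<psi> (a * k mod N))"
    using bij_betw_mult_mod[OF a(1)] N by (intro sum.reindex_bij_betw[symmetric]) auto
  also have "\<dots> = \<psi> a * (\<Sum>k<N. \<psi> k)"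
    by (simp add: periodic mult sum_distrib_left)
  finally show ?thesis using a(2) by simp
qed

lemma norm_partial_sum_le:
  assumes a: "coprime a N" "\<psi> a \<noteq> 1"
  shows "norm (\<Sum>k<n. \<psi> k) \<le> N"
proof (induction n rule: less_induct)
  case (less n)
  show ?case
  proof (cases "n < N")
    case True
    have "norm (\<Sum>k<n. \<psi> k) \<le> (\<Sum>k<n. 1)"
      using norm_le_1 by (intro sum_norm_le) auto
    then show ?thesis using True by simp
  next
    case False
    then obtain m where m: "n = N + m" by (metis le_Suc_ex not_less)
    have "\<psi> (N + k) = \<psi> k" for k using periodic[of "N + k"] periodic[of k] by simp
    then have "(\<Sum>k<n. \<psi> k) = (\<Sum>k<m. \<psi> k)"
      unfolding m sum_lessThan_add_nat using sum_period[OF a] by simp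
    then show ?thesis using less.IH[of m] m N by simp
  qed
qed

lemma norm_partial_sum_Suc_le:
  assumes a: "coprime a N" "\<psi> a \<noteq> 1"
  shows "norm (\<Sum>k<n. \<psi> (Suc k)) \<le> N"
proof -
  have "(\<Sum>k<n. \<psi> (Suc k)) = (\<Sum>k<Suc n. \<psi> k)"
    by (subst sum.lessThan_Suc_shift) (simp add: zero)
  then show ?thesis using norm_partial_sum_le[OF a, of "Suc n"] by (simp only:)
qed

section \<open>L-series on the real half-line \<open>s > 1\<close>\<close>

definition dirichlet_L :: "real \<Rightarrow> complex" where
  "dirichlet_L s = (\<Sum>n. \<psi> (Suc n) * of_real (real (Suc n) powr -s))"

lemma norm_summable_dirichlet_L:
  assumes "s > 1"
  shows "summable (\<lambda>n. norm (\<psi> (Suc n) * of_real (real (Suc n) powr -s)))"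
proof (rule summable_comparison_test[OF _ summable_Suc_powr[OF assms]])
  show "\<exists>M. \<forall>n\<ge>M. norm (norm (\<psi> (Suc n) * of_real (real (Suc n) powr -s))) \<le> real (Suc n) powr -s"
    using norm_le_1 by (intro exI[of _ 0]) (auto simp: norm_mult mult_left_le_one_le)
qed

lemma dirichlet_L_sums:
  assumes "s > 1"
  shows "(\<lambda>n. \<psi> (Suc n) * of_real (real (Suc n) powr -s)) sums dirichlet_L s"
  unfolding dirichlet_L_def
  by (rule summable_sums[OF summable_norm_cancel[OF norm_summable_dirichlet_L[OF assms]]])

lemma norm_dirichlet_L_le:
  assumes a: "coprime a N" "\<psi> a \<noteq> 1" and s: "s > 1"
  shows "norm (dirichlet_L s) \<le> N"
proof -
  have "norm (\<Sum>k<n. \<psi> (Suc k) * of_real (real (Suc k) powr -s)) \<le> N * (real (Suc 0) powr -s)" for n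
    using norm_partial_sum_Suc_le[OF a] s
    by (intro norm_sum_mult_le_antimono) (auto intro: powr_mono2')
  moreover have "(\<lambda>n. norm (\<Sum>k<n. \<psi> (Suc k) * of_real (real (Suc k) powr -s))) \<longlonglongrightarrow> norm (dirichlet_L s)"
    using dirichlet_L_sums[OF s] unfolding sums_def by (rule tendsto_norm)
  ultimately show ?thesis
    by (intro LIMSEQ_le_const2) auto
qed

end

text \<open>By the mean value theorem the increment is
  \<open>\<xi> powr -2 * ((1 - q) - (s - 1) * q)\<close> with \<open>q = \<xi> powr (1 - s)\<close>,
  and the bracket is at most \<open>(s - 1) * (1 + ln \<xi>)\<close>. Absorbing the logarithm in a
  square root costs the exponent 1/2 and leaves the summable 3/2.\<close>

lemma powr_minus_inverse_increment_le:
  fixes x s :: real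
  assumes x: "x \<ge> 1" and s: "1 < s"
  shows "\<bar>(x powr -s - x powr -1) - ((x + 1) powr -s - (x + 1) powr -1)\<bar> \<le> 2 * (s - 1) * x powr -(3/2)"
proof -
  have "\<exists>\<xi>. x < \<xi> \<and> \<xi> < x + 1 \<and> ((x + 1) powr -s - (x + 1) powr -1) - (x powr -s - x powr -1)
      = (x + 1 - x) * (-s * \<xi> powr (-s - 1) - (-1) * \<xi> powr (-1 - 1))"
    using x by (intro MVT2 DERIV_diff has_real_derivative_powr) auto
  then obtain \<xi> where \<xi>: "x < \<xi>" "\<xi> < x + 1"
    "((x + 1) powr -s - (x + 1) powr -1) - (x powr -s - x powr -1) = \<xi> powr -2 - s * \<xi> powr (-s - 1)"
    by auto
  have \<xi>1: "\<xi> \<ge> 1" using \<xi> x by simp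
  define q where "q = \<xi> powr (1 - s)"
  have q: "0 < q" "q \<le> 1"
    using \<xi>1 s powr_mono[of "1 - s" 0 \<xi>] by (auto simp: q_def)
  have q2: "1 - q \<le> (s - 1) * ln \<xi>"
    using exp_ge_add_one_self[of "(1 - s) * ln \<xi>"] \<xi>1 by (simp add: q_def powr_def algebra_simps)
  have split: "\<xi> powr (-s - 1) = \<xi> powr -2 * q"
  proof -
    have "-s - 1 = -2 + (1 - s)" by simp
    then show ?thesis unfolding q_def by (metis powr_add)
  qed
  have "1 + ln \<xi> \<le> 2 * \<xi> powr (1/2)"
  proof -
    have "ln (sqrt \<xi>) \<le> sqrt \<xi> - 1" using \<xi>1 by (intro ln_le_minus_one) auto
    then have "1 + ln \<xi> \<le> 2 * sqrt \<xi>" using \<xi>1 by (simp add: ln_sqrt)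
    then show ?thesis using \<xi>1 by (simp add: powr_half_sqrt)
  qed
  have "\<bar>\<xi> powr -2 - s * \<xi> powr (-s - 1)\<bar> = \<xi> powr -2 * \<bar>(1 - q) - (s - 1) * q\<bar>"
  proof -
    have "\<xi> powr -2 - s * \<xi> powr (-s - 1) = \<xi> powr -2 * ((1 - q) - (s - 1) * q)"
      unfolding split by (simp add: algebra_simps)
    then show ?thesis by (simp only: abs_mult) simp
  qed
  also have "\<dots> \<le> \<xi> powr -2 * ((s - 1) * (1 + ln \<xi>))"
  proof (intro mult_left_mono)
    have "(s - 1) * q \<le> (s - 1) * 1" using q s by (intro mult_left_mono) auto
    moreover have "0 \<le> (s - 1) * q" using q s by simp
    ultimately show "\<bar>(1 - q) - (s - 1) * q\<bar> \<le> (s - 1) * (1 + ln \<xi>)"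
      using q q2 distrib_left[of "s - 1" 1 "ln \<xi>"] by linarith
  qed auto
  also have "\<dots> \<le> \<xi> powr -2 * ((s - 1) * (2 * \<xi> powr (1/2)))"
    using \<open>1 + ln \<xi> \<le> 2 * \<xi> powr (1/2)\<close> s by (intro mult_left_mono) auto
  also have "\<dots> = 2 * (s - 1) * (\<xi> powr -2 * \<xi> powr (1/2))" by (simp add: algebra_simps)
  also have "\<xi> powr -2 * \<xi> powr (1/2) = \<xi> powr -(3/2)" by (simp flip: powr_add)
  also have "2 * (s - 1) * \<xi> powr -(3/2) \<le> 2 * (s - 1) * x powr -(3/2)"
    using \<xi> x s by (intro mult_left_mono powr_mono2') auto
  finally show ?thesis using \<xi>(3) by (simp add: abs_minus_commute)
qed

context dirichlet_character
begin

text \<open>Subtracting the vanishing series at 1 replaces the weights by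
  \<open>n powr -s - n powr -1\<close>, whose total variation is of order \<open>s - 1\<close>. This
  gives the zero at 1 its order without differentiating the L-series.\<close>

lemma norm_dirichlet_L_le_linear:
  assumes a: "coprime a N" "\<psi> a \<noteq> 1"
    and L1: "(\<lambda>n. \<psi> (Suc n) / of_nat (Suc n)) sums 0"
  shows "\<exists>C. \<forall>s>1. norm (dirichlet_L s) \<le> C * (s - 1)"
proof -
  define V where "V = (\<Sum>k. real (Suc k) powr -(3/2))"
  have sm: "summable (\<lambda>k. real (Suc k) powr -(3/2))" by (rule summable_Suc_powr) simp
  have "norm (dirichlet_L s) \<le> (N * (1 + 2 * V)) * (s - 1)" if s: "s > 1" for s
  proof -
    define g where "g k = real (Suc k) powr -s - real (Suc k) powr -1" for k
    have "norm (\<Sum>k<n. \<psi> (Suc k) * of_real (g k)) \<le> (N * (1 + 2 * V)) * (s - 1)" for n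
    proof -
      have "\<bar>g n\<bar> \<le> s - 1"
      proof -
        define x where "x = real (Suc n)"
        have x: "x \<ge> 1" by (simp add: x_def)
        have q: "1 - x powr (1 - s) \<le> (s - 1) * ln x"
          using exp_ge_add_one_self[of "(1 - s) * ln x"] x by (simp add: powr_def algebra_simps)
        have "x powr (1 - s) \<le> 1" using x s powr_mono[of "1 - s" 0 x] by auto
        have "x powr -s = x powr -1 * x powr (1 - s)"
          unfolding powr_add[symmetric] by simp
        then have "g n = - (x powr -1 * (1 - x powr (1 - s)))"
          unfolding g_def x_def[symmetric] by (simp add: right_diff_distrib)
        then have "\<bar>g n\<bar> = x powr -1 * (1 - x powr (1 - s))"
          using \<open>x powr (1 - s) \<le> 1\<close> by (simp add: abs_mult)
        also have "\<dots> \<le> x powr -1 * ((s - 1) * ln x)"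
          using q by (intro mult_left_mono) auto
        also have "\<dots> \<le> x powr -1 * ((s - 1) * x)"
          using s x ln_le_minus_one[of x] by (intro mult_left_mono) auto
        also have "\<dots> = s - 1" using x by (simp add: powr_minus field_simps)
        finally show ?thesis .
      qed
      moreover have "(\<Sum>k<n. \<bar>g k - g (Suc k)\<bar>) \<le> (\<Sum>k<n. 2 * (s - 1) * real (Suc k) powr -(3/2))"
      proof (intro sum_mono)
        fix k
        show "\<bar>g k - g (Suc k)\<bar> \<le> 2 * (s - 1) * real (Suc k) powr -(3/2)"
          using powr_minus_inverse_increment_le[of "real (Suc k)" s] s by (simp add: g_def add_ac)
      qed
      moreover have "(\<Sum>k<n. 2 * (s - 1) * real (Suc k) powr -(3/2)) \<le> 2 * (s - 1) * V"
        unfolding sum_distrib_left[symmetric] V_def using s sm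
        by (intro mult_left_mono sum_le_suminf) auto
      ultimately have "\<bar>g n\<bar> + (\<Sum>k<n. \<bar>g k - g (Suc k)\<bar>) \<le> (1 + 2 * V) * (s - 1)"
        by (simp add: algebra_simps)
      then have "N * (\<bar>g n\<bar> + (\<Sum>k<n. \<bar>g k - g (Suc k)\<bar>)) \<le> N * ((1 + 2 * V) * (s - 1))"
        by (intro mult_left_mono) auto
      then show ?thesis
        using norm_sum_mult_le_variation[of "\<lambda>k. \<psi> (Suc k)" N g n] norm_partial_sum_Suc_le[OF a]
        by (simp add: mult.assoc)
    qed
    moreover have "(\<lambda>n. norm (\<Sum>k<n. \<psi> (Suc k) * of_real (g k))) \<longlonglongrightarrow> norm (dirichlet_L s - 0)"
    proof -
      have "(\<lambda>n. \<psi> (Suc n) * of_real (real (Suc n) powr -s) - \<psi> (Suc n) / of_nat (Suc n)) sums (dirichlet_L s - 0)"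
        by (intro sums_diff dirichlet_L_sums L1 s)
      moreover have "\<psi> (Suc n) * of_real (real (Suc n) powr -s) - \<psi> (Suc n) / of_nat (Suc n)
          = \<psi> (Suc n) * of_real (g n)" for n
        by (simp add: g_def powr_minus right_diff_distrib divide_inverse del: of_nat_Suc)
      ultimately have "(\<lambda>n. \<psi> (Suc n) * of_real (g n)) sums (dirichlet_L s - 0)" by simp
      then show ?thesis unfolding sums_def by (rule tendsto_norm)
    qed
    ultimately show ?thesis
      by (intro LIMSEQ_le_const2[where X = "\<lambda>n. norm (\<Sum>k<n. \<psi> (Suc k) * of_real (g k))"]) auto
  qed
  then show ?thesis by blast
qed

text \<open>Monsky: if \<open>L(1, \<psi>) = 0\<close>, the Lambert series of \<open>\<psi>\<close> stays bounded as \<open>t\<close> tends to 1, but its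
  coefficients \<open>\<Sum>d dvd m. \<psi> d\<close> are nonnegative, and at least 1 when \<open>m\<close> is a square.\<close>

lemma L_1_nonzero_real:
  assumes a: "coprime a N" "\<psi> a \<noteq> 1"
    and real: "\<And>n. coprime n N \<Longrightarrow> (\<psi> n)\<^sup>2 = 1"
  shows "\<not> (\<lambda>n. \<psi> (Suc n) / of_nat (Suc n)) sums 0"
proof
  assume L1: "(\<lambda>n. \<psi> (Suc n) / of_nat (Suc n)) sums 0"
  define r where "r n = Re (\<psi> n)" for n
  have chi: "\<psi> n = of_real (r n)" "r n \<in> {0, 1, -1}" for n
  proof -
    have "\<psi> n = 0 \<or> \<psi> n = 1 \<or> \<psi> n = -1"
      using real[of n] eq_0[of n] by (cases "coprime n N") (auto simp: power2_eq_1_iff)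
    then show "\<psi> n = of_real (r n)" "r n \<in> {0, 1, -1}" unfolding r_def by auto
  qed
  have r: "r (m * n) = r m * r n" "r 1 = 1" for m n
    using mult[of m n] one unfolding chi(1) by (metis of_real_mult of_real_eq_iff of_real_1)+
  have bound: "real M * t ^ (M\<^sup>2) \<le> N" if t: "0 < t" "t < 1" for t M
  proof -
    have r1: "\<bar>r n\<bar> \<le> 1" for n using chi(2)[of n] by auto
    obtain S where S: "(\<lambda>n. r (Suc n) * (t ^ Suc n / (1 - t ^ Suc n))) sums S"
      by (rule lambert_series_has_sum[OF t r1])
    have "norm (\<Sum>k<n. \<psi> (Suc k) * of_real (lambert_weight t (Suc k))) \<le> N * lambert_weight t (Suc 0)" for n
      using norm_partial_sum_Suc_le[OF a] lambert_weight_antimono[OF t] lambert_weight_nonneg[OF t]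
      by (intro norm_sum_mult_le_antimono) auto
    moreover have "lambert_weight t (Suc 0) = 1"
      using t by (simp add: lambert_weight_def field_simps)
    ultimately have bnd: "norm (\<Sum>k<n. \<psi> (Suc k) * of_real (lambert_weight t (Suc k))) \<le> N" for n
      by simp
    \<comment> \<open>The vanishing series, scaled by \<open>1 / (1 - t)\<close>, is added at no
      cost; it turns the Lambert coefficients into the monotone weights
      \<open>lambert_weight t\<close>.\<close>
    have "(\<lambda>n. 1 / (1 - of_real t) * (\<psi> (Suc n) / of_nat (Suc n))
        - of_real (r (Suc n) * (t ^ Suc n / (1 - t ^ Suc n)))) sums (1 / (1 - of_real t) * 0 - of_real S)"
      by (intro sums_diff sums_mult L1) (use S sums_of_real in blast)
    moreover have "1 / (1 - of_real t) * (\<psi> (Suc n) / of_nat (Suc n))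
        - of_real (r (Suc n) * (t ^ Suc n / (1 - t ^ Suc n)))
        = \<psi> (Suc n) * of_real (lambert_weight t (Suc n))" for n
      unfolding chi(1) lambert_weight_def
      by (simp add: right_diff_distrib mult.commute del: of_nat_Suc)
    ultimately have "(\<lambda>n. \<psi> (Suc n) * of_real (lambert_weight t (Suc n))) sums (- of_real S)"
      by simp
    then have "(\<lambda>n. norm (\<Sum>k<n. \<psi> (Suc k) * of_real (lambert_weight t (Suc k)))) \<longlonglongrightarrow> norm (- of_real S :: complex)"
      unfolding sums_def by (rule tendsto_norm)
    then have "norm (- of_real S :: complex) \<le> N"
      by (rule LIMSEQ_le_const2) (use bnd in blast)
    then have "S \<le> N" by simp
    moreover have "real M * t ^ (M\<^sup>2) \<le> S"
      by (rule lambert_series_ge[OF t r(1) r(2) chi(2) S])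
    ultimately show ?thesis by linarith
  qed
  \<comment> \<open>The bound is uniform in \<open>t\<close>, so letting \<open>t\<close> tend to 1
    with \<open>M\<close> fixed gives \<open>M \<le> N\<close>.\<close>
  define M where "M = Suc N"
  have "((\<lambda>t. real M * t ^ (M\<^sup>2)) \<longlongrightarrow> real M * 1 ^ (M\<^sup>2)) (at_left 1)"
    by (intro tendsto_intros)
  moreover have "\<forall>\<^sub>F t in at_left 1. real M * t ^ (M\<^sup>2) \<le> N"
    unfolding eventually_at_left_field using bound by (intro exI[of _ 0]) auto
  ultimately have "real M * 1 ^ (M\<^sup>2) \<le> N"
    by (rule tendsto_upperbound) simp
  then show False by (simp add: M_def)
qed

lemma euler_product_L_tendsto_1:
  assumes s: "s > 1"
  shows "(\<lambda>y. dirichlet_L s * (\<Prod>p | prime p \<and> p \<le> y. 1 - \<psi> p * of_real (real p powr -s))) \<longlonglongrightarrow> 1"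
proof -
  define f where "f n = \<psi> n * of_real (real n powr -s)" for n
  have sm: "summable (\<lambda>n. norm (f n))"
    using norm_summable_dirichlet_L[OF s] unfolding f_def[symmetric] by (subst summable_Suc_iff[symmetric])
  have f0: "f 0 = 0" by (simp add: f_def)
  have "(\<lambda>n. f (Suc n)) sums dirichlet_L s"
    unfolding f_def by (rule dirichlet_L_sums[OF s])
  then have "f sums dirichlet_L s" using f0 by (simp add: sums_Suc_iff)
  then have "(\<Sum>n. f n) = dirichlet_L s" by (rule sums_unique[symmetric])
  moreover have "f (m * n) = f m * f n" for m n
    by (simp add: f_def mult powr_mult)
  ultimately show ?thesis
    using euler_product_tendsto_1[OF _ sm f0] one unfolding f_def by simp
qed

text \<open>In the product of the third power for the principal character, the fourth power for
  \<psi> and the first for its square, a zero at 1 would contribute order four against a pole of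
  order three, while the square is nonprincipal and stays bounded. The product would tend to 0, but
  its norm is at least 1 because every local factor has norm at most 1.\<close>

lemma L_1_nonzero_complex:
  assumes a: "coprime a N" "(\<psi> a)\<^sup>2 \<noteq> 1"
  shows "\<not> (\<lambda>n. \<psi> (Suc n) / of_nat (Suc n)) sums 0"
proof
  assume L1: "(\<lambda>n. \<psi> (Suc n) / of_nat (Suc n)) sums 0"
  interpret sq: dirichlet_character N "\<lambda>n. (\<psi> n)\<^sup>2" by (rule square_character)
  interpret pr: dirichlet_character N "\<lambda>n. of_real (norm (\<psi> n))"
    using N one eq_0 by unfold_locales (auto simp: periodic mult norm_mult)
  have "\<psi> a \<noteq> 1" using a by auto
  then obtain C where C: "\<And>s. s > 1 \<Longrightarrow> norm (dirichlet_L s) \<le> C * (s - 1)"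
    using norm_dirichlet_L_le_linear[OF a(1) _ L1] by blast
  have prbound: "norm (pr.dirichlet_L s) \<le> s / (s - 1)" if s: "s > 1" for s
  proof -
    have "norm (pr.dirichlet_L s) \<le> (\<Sum>n. real (Suc n) powr -s)"
      unfolding pr.dirichlet_L_def
      using norm_le_1 by (intro norm_suminf_le summable_Suc_powr s) (auto simp: norm_mult mult_left_le_one_le)
    also have "\<dots> \<le> s / (s - 1)" by (rule suminf_Suc_powr_le[OF s])
    finally show ?thesis .
  qed
  have lower: "1 \<le> norm (pr.dirichlet_L s ^ 3 * dirichlet_L s ^ 4 * sq.dirichlet_L s)" if s: "s > 1" for s
  proof -
    let ?P = "\<lambda>y. {p. prime p \<and> p \<le> (y::nat)}"
    let ?T = "pr.dirichlet_L s ^ 3 * dirichlet_L s ^ 4 * sq.dirichlet_L s"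
    let ?x = "\<lambda>p. of_real (real p powr -s) :: complex"
    let ?e = "\<lambda>p. (1 - of_real (norm (\<psi> p)) * ?x p) ^ 3 * (1 - \<psi> p * ?x p) ^ 4 * (1 - (\<psi> p)\<^sup>2 * ?x p)"
    have "(\<lambda>y. (pr.dirichlet_L s * (\<Prod>p\<in>?P y. 1 - of_real (norm (\<psi> p)) * ?x p)) ^ 3
        * (dirichlet_L s * (\<Prod>p\<in>?P y. 1 - \<psi> p * ?x p)) ^ 4
        * (sq.dirichlet_L s * (\<Prod>p\<in>?P y. 1 - (\<psi> p)\<^sup>2 * ?x p))) \<longlonglongrightarrow> 1 ^ 3 * 1 ^ 4 * 1"
      by (intro tendsto_mult tendsto_power pr.euler_product_L_tendsto_1 euler_product_L_tendsto_1
          sq.euler_product_L_tendsto_1 s)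
    moreover have "(pr.dirichlet_L s * (\<Prod>p\<in>?P y. 1 - of_real (norm (\<psi> p)) * ?x p)) ^ 3
        * (dirichlet_L s * (\<Prod>p\<in>?P y. 1 - \<psi> p * ?x p)) ^ 4
        * (sq.dirichlet_L s * (\<Prod>p\<in>?P y. 1 - (\<psi> p)\<^sup>2 * ?x p)) = ?T * (\<Prod>p\<in>?P y. ?e p)" for y
      by (simp only: prod.distrib prod_power_distrib power_mult_distrib ac_simps)
    ultimately have "(\<lambda>y. norm (?T * (\<Prod>p\<in>?P y. ?e p))) \<longlonglongrightarrow> norm (1 ^ 3 * 1 ^ 4 * 1 :: complex)"
      by (intro tendsto_norm) simp
    then have lim: "(\<lambda>y. norm (?T * (\<Prod>p\<in>?P y. ?e p))) \<longlonglongrightarrow> 1" by simp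
    have e: "norm (?e p) \<le> 1" if p: "prime p" for p
    proof (cases "coprime p N")
      case True
      have "real p > 1" using prime_gt_1_nat[OF p] by simp
      then have "real p powr -s < 1" using s powr_less_mono[of "-s" 0 "real p"] by simp
      then show ?thesis
        using norm_three_four_one_le[of "real p powr -s" "\<psi> p"] norm_coprime[OF True] by simp
    next
      case False
      then show ?thesis by (simp add: eq_0)
    qed
    have "norm (?T * (\<Prod>p\<in>?P y. ?e p)) \<le> norm ?T" for y
    proof -
      have "norm (\<Prod>p\<in>?P y. ?e p) \<le> 1"
        unfolding prod_norm[symmetric] using e by (intro prod_le_1) auto
      then show ?thesis by (simp only: norm_mult[of ?T]) (simp add: mult_left_le)
    qed
    then show ?thesis by (intro LIMSEQ_le_const2[OF lim]) blast
  qed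
  \<comment> \<open>The 8 is the cube of the 2 in \<open>s / (s - 1) \<le> 2 / \<epsilon>\<close>,
    valid for \<open>\<epsilon> \<le> 1\<close>. Taking \<open>\<epsilon> = 1\<close> gives
    \<open>K \<ge> 1\<close>, so \<open>1 / (2 * K)\<close> is an admissible contradictory
    choice.\<close>
  define K where "K = 8 * C ^ 4 * N"
  have "1 \<le> K * \<epsilon>" if eps: "0 < \<epsilon>" "\<epsilon> \<le> 1" for \<epsilon>
  proof -
    define s where "s = 1 + \<epsilon>"
    have s: "s > 1" "s - 1 = \<epsilon>" using eps by (auto simp: s_def)
    have "norm (pr.dirichlet_L s) \<le> 2 / \<epsilon>"
      using prbound[OF s(1)] eps by (simp add: s_def field_simps)
    moreover have "norm (dirichlet_L s) \<le> C * \<epsilon>" using C[OF s(1)] s(2) by simp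
    moreover have "norm (sq.dirichlet_L s) \<le> N" using sq.norm_dirichlet_L_le[OF a s(1)] .
    ultimately have "norm (pr.dirichlet_L s) ^ 3 * norm (dirichlet_L s) ^ 4 * norm (sq.dirichlet_L s)
        \<le> (2 / \<epsilon>) ^ 3 * (C * \<epsilon>) ^ 4 * N"
      using eps by (intro mult_mono power_mono) auto
    also have "\<dots> = K * \<epsilon>"
      using eps by (simp add: K_def field_simps power3_eq_cube power4_eq_xxxx)
    finally show ?thesis using lower[OF s(1)] by (simp add: norm_mult norm_power)
  qed
  note K = this
  have "K \<ge> 1" using K[of 1] by simp
  then show False using K[of "1 / (2 * K)"] by (simp add: field_simps)
qed

theorem L_1_nonzero:
  assumes a: "coprime a N" "\<psi> a \<noteq> 1"
  shows "\<not> (\<lambda>n. \<psi> (Suc n) / of_nat (Suc n)) sums 0"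
  using L_1_nonzero_real[OF a] L_1_nonzero_complex by blast

end

section \<open>Partial fractions of the cotangent\<close>

lemma cis_2pi_power_eq_1_iff:
  assumes "m > 0"
  shows "cis (2 * pi / real m) ^ k = 1 \<longleftrightarrow> m dvd k"
proof
  assume "m dvd k"
  then obtain j where "k = m * j" by blast
  then have "real k * (2 * pi / real m) = 2 * pi * real j" using assms by simp
  then show "cis (2 * pi / real m) ^ k = 1"
    unfolding Complex.DeMoivre by (metis Ints_of_nat cis_multiple_2pi)
next
  assume "cis (2 * pi / real m) ^ k = 1"
  then have "cis (real k * (2 * pi / real m)) = 1" by (simp add: Complex.DeMoivre)
  then have "cos (real k * (2 * pi / real m)) = 1" by (metis cis.sel(1) one_complex.sel(1))
  then obtain j :: int where "real k * (2 * pi / real m) = of_int j * 2 * pi"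
    by (auto simp: cos_one_2pi_int)
  then have "real k = of_int j * real m" using assms by (simp add: field_simps)
  then have "int k = j * int m" by (metis of_int_eq_iff of_int_mult of_int_of_nat_eq)
  then show "m dvd k" by (metis dvd_triv_right int_dvd_int_iff)
qed

lemma sum_powers_root_of_unity:
  assumes "m > 0"
  shows "(\<Sum>j<m. (cis (2 * pi / real m) ^ i) ^ j) = (if m dvd i then of_nat m else 0)"
proof (cases "m dvd i")
  case True
  then have "cis (2 * pi / real m) ^ i = 1" using cis_2pi_power_eq_1_iff[OF assms] by simp
  then show ?thesis using True by simp
next
  case False
  let ?w = "cis (2 * pi / real m) ^ i"
  have "?w \<noteq> 1" using False cis_2pi_power_eq_1_iff[OF assms] by simp
  moreover have "?w ^ m = 1"
    using cis_2pi_power_eq_1_iff[OF assms, of "i * m"] by (simp add: power_mult)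
  ultimately show ?thesis using False by (simp add: geometric_sum)
qed

text \<open>The logarithmic derivative of the reflection formula for Gamma.\<close>

lemma Digamma_reflection_real:
  fixes x :: real
  assumes x: "0 < x" "x < 1"
  shows "Digamma (1 - x) - Digamma x = pi * cot (pi * x)"
proof -
  have refl: "Gamma y * Gamma (1 - y) = pi / sin (pi * y)" for y :: real
  proof -
    have "complex_of_real (Gamma y * Gamma (1 - y)) = of_real (pi / sin (pi * y))"
      using Gamma_reflection_complex[of "of_real y"] sin_of_real[of "pi * y", where ?'a = complex]
      by (simp add: Gamma_complex_of_real[symmetric])
    then show ?thesis by (simp only: of_real_eq_iff)
  qed
  have nz: "x \<notin> \<int>\<^sub>\<le>\<^sub>0" "1 - x \<notin> \<int>\<^sub>\<le>\<^sub>0" using x by (auto elim!: nonpos_Ints_cases)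
  have sin: "sin (pi * x) > 0" using x by (intro sin_gt_zero) auto
  let ?D = "Gamma x * Gamma (1 - x) * (Digamma x - Digamma (1 - x))"
  have "((\<lambda>y. Gamma y * Gamma (1 - y)) has_real_derivative ?D) (at x)"
    using nz by (auto intro!: derivative_eq_intros simp: algebra_simps)
  then have "((\<lambda>y. pi / sin (pi * y)) has_real_derivative ?D) (at x)"
    by (simp only: refl)
  moreover have "((\<lambda>y. pi / sin (pi * y)) has_real_derivative
      - (pi * (pi * cos (pi * x))) / (sin (pi * x) * sin (pi * x))) (at x)"
    using sin by (auto intro!: derivative_eq_intros)
  ultimately have "?D = - (pi * (pi * cos (pi * x))) / (sin (pi * x) * sin (pi * x))"
    by (rule DERIV_unique)
  then have "pi / sin (pi * x) * (Digamma x - Digamma (1 - x))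
      = pi / sin (pi * x) * (- (pi * cot (pi * x)))"
    unfolding refl by (simp add: cot_def)
  moreover have "pi / sin (pi * x) \<noteq> 0" using sin by simp
  ultimately have "Digamma x - Digamma (1 - x) = - (pi * cot (pi * x))"
    by (metis mult_left_cancel)
  then show ?thesis by simp
qed

text \<open>Both Digamma values are limits of \<open>ln M\<close> minus a sum of reciprocals, and
  the logarithms cancel in the difference.\<close>

lemma cot_partial_fractions:
  fixes x :: real
  assumes x: "0 < x" "x < 1"
  shows "(\<lambda>M. \<Sum>m<M. 1 / (x + real m) - 1 / (1 - x + real m)) \<longlonglongrightarrow> pi * cot (pi * x)"
proof -
  have "(\<lambda>M. (of_real (ln (real M)) - (\<Sum>m<M. inverse (1 - x + of_nat m)))
      - (of_real (ln (real M)) - (\<Sum>m<M. inverse (x + of_nat m)))) \<longlonglongrightarrow> Digamma (1 - x) - Digamma x"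
    using x by (intro tendsto_diff Digamma_LIMSEQ) auto
  then show ?thesis
    unfolding Digamma_reflection_real[OF x] by (simp add: sum_subtractf divide_inverse)
qed

text \<open>Within each block of length \<open>N\<close>, pairing \<open>k\<close> with
  \<open>N - k\<close> produces the terms of the cotangent expansion; counting each pair twice
  accounts for the 2 in the constant. An incomplete last block after \<open>q\<close> full ones
  contributes at most \<open>B / q\<close>, so the limit along multiples of \<open>N\<close> is the
  limit of all partial sums.\<close>

lemma odd_periodic_sums:
  fixes f :: "nat \<Rightarrow> complex"
  assumes N: "N > 0" and periodic: "\<And>n. f (n mod N) = f n" and f0: "f 0 = 0"
    and odd: "\<And>k. 0 < k \<Longrightarrow> k < N \<Longrightarrow> f (N - k) = - f k"
  shows "(\<lambda>n. f n / of_nat n) sums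
    (of_real (pi / (2 * real N)) * (\<Sum>k=1..<N. f k * of_real (cot (pi * real k / real N))))"
    (is "_ sums ?L")
proof -
  define S where "S n = (\<Sum>k<n. f k / of_nat k)" for n
  have block: "(\<Sum>k<N. f k / of_nat (m * N + k)) = of_real (1 / (2 * real N)) *
      (\<Sum>k=1..<N. f k * of_real (1 / (real k / real N + real m) - 1 / (1 - real k / real N + real m)))" for m
  proof -
    have drop0: "(\<Sum>k<N. f k / of_nat (m * N + k)) = (\<Sum>k=1..<N. f k / of_nat (m * N + k))"
      by (rule sum.mono_neutral_right) (auto simp: f0 not_le)
    have "2 * (\<Sum>k=1..<N. f k / of_nat (m * N + k)) = (\<Sum>k=1..<N. f k / of_nat (m * N + k)) + (\<Sum>k=1..<N. f (N - k) / of_nat (m * N + (N - k)))"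
    proof -
      have "(\<Sum>k=1..<N. f (N - k) / of_nat (m * N + (N - k))) = (\<Sum>k=1..<N. f k / of_nat (m * N + k))"
        by (rule sum.reindex_bij_witness[of _ "\<lambda>k. N - k" "\<lambda>k. N - k"]) auto
      then show ?thesis by simp
    qed
    also have "\<dots> = (\<Sum>k=1..<N. of_real (1 / real N) * (f k * of_real (1 / (real k / real N + real m) - 1 / (1 - real k / real N + real m))))"
      unfolding sum.distrib[symmetric]
    proof (intro sum.cong refl)
      fix k assume k: "k \<in> {1..<N}"
      have "real k / real N + real m = (real m * real N + real k) / real N"
        "1 - real k / real N + real m = (real m * real N + (real N - real k)) / real N"
        using N by (simp_all add: field_simps)
      then have "1 / real N * (1 / (real k / real N + real m) - 1 / (1 - real k / real N + real m))
          = 1 / real (m * N + k) - 1 / real (m * N + (N - k))"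
        using N k by (simp add: right_diff_distrib of_nat_diff)
      then have "of_real (1 / real N) * of_real (1 / (real k / real N + real m) - 1 / (1 - real k / real N + real m))
          = (1 / of_nat (m * N + k) - 1 / of_nat (m * N + (N - k)) :: complex)"
        unfolding of_real_mult[symmetric] by simp
      then have "f k * (of_real (1 / real N) * of_real (1 / (real k / real N + real m) - 1 / (1 - real k / real N + real m)))
          = f k * (1 / of_nat (m * N + k) - 1 / of_nat (m * N + (N - k)))" by (rule arg_cong)
      moreover have "f (N - k) = - f k" using k odd by auto
      ultimately show "f k / of_nat (m * N + k) + f (N - k) / of_nat (m * N + (N - k))
          = of_real (1 / real N) * (f k * of_real (1 / (real k / real N + real m) - 1 / (1 - real k / real N + real m)))"
        by (simp only: mult.left_commute) (simp add: right_diff_distrib)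
    qed
    finally have twice: "2 * (\<Sum>k=1..<N. f k / of_nat (m * N + k)) = of_real (1 / real N) *
      (\<Sum>k=1..<N. f k * of_real (1 / (real k / real N + real m) - 1 / (1 - real k / real N + real m)))"
      unfolding sum_distrib_left[symmetric] .
    have half: "A = of_real (1 / (2 * real N)) * C" if "2 * A = of_real (1 / real N) * C" for A C :: complex
      using that N by (simp add: field_simps)
    show ?thesis unfolding drop0 by (rule half[OF twice])
  qed
  have SN: "S (M * N) = of_real (1 / (2 * real N)) * (\<Sum>k=1..<N. f k *
      of_real (\<Sum>m<M. 1 / (real k / real N + real m) - 1 / (1 - real k / real N + real m)))" for M
  proof (induction M)
    case 0
    show ?case by (simp add: S_def)
  next
    case (Suc M)
    have f_shift: "f (M * N + k) = f k" for k
      using periodic[of "M * N + k"] periodic[of k] by simp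
    have "S (Suc M * N) = S (M * N) + (\<Sum>k<N. f k / of_nat (M * N + k))"
      unfolding S_def using sum_lessThan_add_nat[of "\<lambda>k. f k / of_nat k" "M * N" N]
      by (simp only: mult_Suc add.commute[of N] f_shift)
    then show ?case unfolding Suc.IH block
      by (simp only: sum.lessThan_Suc of_real_add distrib_left sum.distrib)
  qed
  have "(\<lambda>M. S (M * N)) \<longlonglongrightarrow> of_real (1 / (2 * real N)) * (\<Sum>k=1..<N. f k * of_real (pi * cot (pi * (real k / real N))))"
    unfolding SN
    by (intro tendsto_mult tendsto_const tendsto_sum tendsto_of_real cot_partial_fractions) auto
  also have "of_real (1 / (2 * real N)) * (\<Sum>k=1..<N. f k * of_real (pi * cot (pi * (real k / real N)))) = ?L"
    unfolding sum_distrib_left by (intro sum.cong) auto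
  finally have lim: "(\<lambda>M. S (M * N)) \<longlonglongrightarrow> ?L" .
  have div: "filterlim (\<lambda>n. n div N) at_top at_top"
    using N by (rule filterlim_at_top_div_const_nat)
  have lim1: "(\<lambda>n. S (n div N * N)) \<longlonglongrightarrow> ?L"
    by (rule filterlim_compose[OF lim div])
  define B where "B = Max ((\<lambda>k. norm (f k)) ` {..<N})"
  have B: "norm (f k) \<le> B" for k
  proof -
    have "norm (f (k mod N)) \<le> B" unfolding B_def using N by (intro Max_ge) auto
    then show ?thesis by (simp add: periodic)
  qed
  have B0: "0 \<le> B" using B[of 0] norm_ge_zero order_trans by blast
  have bnd: "norm (S n - S (n div N * N)) \<le> B / real (n div N)" if n: "n \<ge> N" for n
  proof -
    define q where "q = n div N"
    have "n = q * N + n mod N" by (simp add: q_def)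
    then have "S n = S (q * N) + (\<Sum>k<n mod N. f (q * N + k) / of_nat (q * N + k))"
      unfolding S_def using sum_lessThan_add_nat[of "\<lambda>k. f k / of_nat k" "q * N" "n mod N"] by simp
    then have "norm (S n - S (q * N)) = norm (\<Sum>k<n mod N. f (q * N + k) / of_nat (q * N + k))" by simp
    also have "\<dots> \<le> (\<Sum>k<n mod N. B / real (q * N))"
    proof (intro sum_norm_le)
      fix k
      have "q * N > 0" using n N by (simp add: q_def div_greater_zero_iff)
      then show "norm (f (q * N + k) / of_nat (q * N + k)) \<le> B / real (q * N)"
        using B[of "q * N + k"] B0 by (simp only: norm_divide norm_of_nat) (intro frac_le, auto)
    qed
    also have "\<dots> = real (n mod N) * (B / real (q * N))" by simp
    also have "\<dots> \<le> real N * (B / real (q * N))"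
      using N B0 by (intro mult_right_mono) (auto intro: less_imp_le)
    also have "\<dots> = B / real q" using N by simp
    finally show ?thesis by (simp add: q_def)
  qed
  have "(\<lambda>n. B / real (n div N)) \<longlonglongrightarrow> 0"
    by (intro tendsto_divide_0[OF tendsto_const] filterlim_at_top_imp_at_infinity
        filterlim_compose[OF filterlim_real_sequentially div])
  moreover have "\<forall>\<^sub>F n in sequentially. norm (S n - S (n div N * N)) \<le> B / real (n div N)"
    using bnd by (rule eventually_sequentiallyI)
  ultimately have "(\<lambda>n. S n - S (n div N * N)) \<longlonglongrightarrow> 0"
    by (rule Lim_null_comparison[rotated])
  from tendsto_add[OF this lim1] have "S \<longlonglongrightarrow> ?L" by simp
  then show ?thesis unfolding sums_def S_def .
qed

section \<open>Translation eigenvectors\<close>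

text \<open>The averages of \<open>f\<close> over the powers of \<open>a\<close>, twisted by the roots of unity, are eigenvectors of
  the translation by \<open>a\<close> and add up to a multiple of \<open>f\<close>, so one of them is nonzero.\<close>

lemma exists_translation_eigenvector:
  fixes P :: "(nat \<Rightarrow> complex) \<Rightarrow> bool" and f :: "nat \<Rightarrow> complex"
  assumes N: "N > 1"
    and closed: "\<And>f a c m. P f \<Longrightarrow> coprime a N \<Longrightarrow> P (\<lambda>n. \<Sum>i<m. c i * f (a ^ i * n))"
    and periodic: "\<And>f n. P f \<Longrightarrow> f (n mod N) = f n"
    and f: "P f" "f n0 \<noteq> 0"
  shows "\<exists>g. P g \<and> (\<exists>n. g n \<noteq> 0) \<and> (\<forall>a. coprime a N \<longrightarrow> (\<exists>l. \<forall>n. g (a * n) = l * g n))"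
proof -
  have per: "g (x * n) = g (y * n)" if "P g" "[x = y] (mod N)" for g x y n
    using periodic[OF that(1), of "x * n"] periodic[OF that(1), of "y * n"] that(2)
    by (metis cong_def cong_scalar_right)
  have on_set: "\<exists>g. P g \<and> (\<exists>n. g n \<noteq> 0) \<and> (\<forall>a\<in>S. \<exists>l. \<forall>n. g (a * n) = l * g n)"
    if "finite S" "S \<subseteq> {a. coprime a N}" for S
    using that
  proof (induction S)
    case empty
    then show ?case using f by blast
  next
    case (insert a S)
    then obtain g n1 where g: "P g" "g n1 \<noteq> 0" "\<And>b. b \<in> S \<Longrightarrow> \<exists>l. \<forall>n. g (b * n) = l * g n"
      by auto
    have a: "coprime a N" using insert.prems by auto
    define m where "m = totient N"
    have m: "m > 0" using N by (simp add: m_def)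
    define w where "w = cis (2 * pi / real m)"
    define h where "h j n = (\<Sum>i<m. (w ^ j) ^ i * g (a ^ i * n))" for j n
    have wm: "(w ^ j) ^ m = 1" "w \<noteq> 0" for j
      using cis_2pi_power_eq_1_iff[OF m, of "j * m"] by (auto simp: w_def power_mult)
    have am: "g (a ^ m * n) = g n" for n
      using per[OF g(1) euler_theorem[OF a], of n] by (simp add: m_def)
    have "(\<Sum>j<m. h j n1) = (\<Sum>i<m. \<Sum>j<m. (w ^ j) ^ i * g (a ^ i * n1))"
      unfolding h_def by (rule sum.swap)
    also have "\<dots> = (\<Sum>i<m. (\<Sum>j<m. (w ^ i) ^ j) * g (a ^ i * n1))"
      unfolding sum_distrib_right by (simp add: mult.commute flip: power_mult)
    also have "\<dots> = (\<Sum>i<m. if i = 0 then of_nat m * g n1 else 0)"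
      unfolding w_def sum_powers_root_of_unity[OF m] by (intro sum.cong) (auto dest: dvd_imp_le)
    also have "\<dots> = of_nat m * g n1" using m by simp
    finally have "(\<Sum>j<m. h j n1) \<noteq> 0" using g(2) m by simp
    then obtain j where j: "h j n1 \<noteq> 0" by (meson sum.not_neutral_contains_not_neutral)
    define c where "c = w ^ j"
    have c: "c \<noteq> 0" "c ^ m = 1" using wm by (auto simp: c_def)
    have "c * h j (a * n) = h j n" for n
    proof -
      have "c * h j (a * n) = (\<Sum>i<m. c ^ Suc i * g (a ^ Suc i * n))"
        unfolding h_def c_def[symmetric] sum_distrib_left by (simp add: mult_ac)
      moreover have "(\<Sum>i<Suc m. c ^ i * g (a ^ i * n)) = g n + (\<Sum>i<m. c ^ Suc i * g (a ^ Suc i * n))"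
        by (subst sum.lessThan_Suc_shift) simp
      moreover have "(\<Sum>i<Suc m. c ^ i * g (a ^ i * n)) = h j n + g n"
        unfolding h_def c_def[symmetric] by (simp add: c am)
      ultimately show ?thesis by simp
    qed
    then have "\<forall>n. h j (a * n) = inverse c * h j n"
      using c(1) by (metis (no_types) left_inverse mult.assoc mult_1)
    \<comment> \<open>Translations commute, so averaging over the powers of \<open>a\<close>
      preserves the eigenvalues already secured on \<open>S\<close>.\<close>
    moreover have "\<exists>l. \<forall>n. h j (b * n) = l * h j n" if b: "b \<in> S" for b
    proof -
      obtain l where l: "\<And>n. g (b * n) = l * g n" using g(3)[OF b] by blast
      have "g (a ^ i * (b * n)) = l * g (a ^ i * n)" for i n
        using l[of "a ^ i * n"] by (simp add: mult_ac)
      then have "\<forall>n. h j (b * n) = l * h j n"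
        unfolding h_def sum_distrib_left by (simp add: mult_ac)
      then show ?thesis by blast
    qed
    moreover have "P (h j)" unfolding h_def using closed[OF g(1) a] by blast
    ultimately show ?case using j by (intro exI[of _ "h j"]) blast
  qed
  have "finite {a. a < N \<and> coprime a N}" "{a. a < N \<and> coprime a N} \<subseteq> {a. coprime a N}" by auto
  from on_set[OF this] obtain g where g: "P g" "\<exists>n. g n \<noteq> 0"
    "\<And>a. a < N \<Longrightarrow> coprime a N \<Longrightarrow> \<exists>l. \<forall>n. g (a * n) = l * g n"
    by auto
  have "\<exists>l. \<forall>n. g (a * n) = l * g n" if "coprime a N" for a
  proof -
    have "a mod N < N" "coprime (a mod N) N" using that N by auto
    from g(3)[OF this] obtain l where l: "\<And>n. g (a mod N * n) = l * g n" by blast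
    have "g (a * n) = g (a mod N * n)" for n
      by (rule per[OF g(1)]) (simp add: cong_def)
    then show ?thesis using l by auto
  qed
  then show ?thesis using g by blast
qed

text \<open>On the naturals, -1 is represented by the residue \<open>N - 1\<close>. Vanishing off
  the units is included because a character has to come out of \<open>f\<close>.\<close>

definition odd_periodic :: "nat \<Rightarrow> (nat \<Rightarrow> complex) \<Rightarrow> bool" where
  "odd_periodic N f \<longleftrightarrow> (\<forall>n. f (n mod N) = f n) \<and> (\<forall>n. \<not> coprime n N \<longrightarrow> f n = 0)
    \<and> (\<forall>n. f ((N - 1) * n) = - f n)"

text \<open>The property \<open>P\<close> joins oddness with the vanishing of all translated
  relations, which makes it stable under the averaging that produces eigenvectors. A nonzero
  \<open>f\<close> would thus give a normalised eigenvector, an odd character, that still satisfies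
  the cotangent relation.\<close>

lemma cot_translates_eq_0_imp_eq_0:
  assumes N: "N \<ge> 3" and f: "odd_periodic N f"
    and cot: "\<And>a. coprime a N \<Longrightarrow> (\<Sum>k=1..<N. f (a * k) * of_real (cot (pi * real k / real N))) = 0"
  shows "f n = 0"
proof (rule ccontr)
  assume nz: "f n \<noteq> 0"
  define P where "P f \<longleftrightarrow> odd_periodic N f \<and>
    (\<forall>a. coprime a N \<longrightarrow> (\<Sum>k=1..<N. f (a * k) * of_real (cot (pi * real k / real N))) = 0)" for f
  have closed: "P (\<lambda>n. \<Sum>i<m. c i * f (a ^ i * n))" if Pf: "P f" and a: "coprime a N" for f a c m
  proof -
    have f: "\<And>n. f (n mod N) = f n" "\<And>n. \<not> coprime n N \<Longrightarrow> f n = 0" "\<And>n. f ((N - 1) * n) = - f n"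
      "\<And>a. coprime a N \<Longrightarrow> (\<Sum>k=1..<N. f (a * k) * of_real (cot (pi * real k / real N))) = 0"
      using Pf unfolding P_def odd_periodic_def by blast+
    have "f (a ^ i * (n mod N)) = f (a ^ i * n)" for i n
      by (metis f(1) mod_mult_right_eq)
    moreover have "f (a ^ i * n) = 0" if "\<not> coprime n N" for i n
      using that by (intro f(2)) simp
    moreover have "f (a ^ i * ((N - 1) * n)) = - f (a ^ i * n)" for i n
      using f(3)[of "a ^ i * n"] by (simp add: mult_ac)
    moreover have "(\<Sum>k=1..<N. (\<Sum>i<m. c i * f (a ^ i * (b * k))) * of_real (cot (pi * real k / real N))) = 0"
      if b: "coprime b N" for b
    proof -
      have "(\<Sum>k=1..<N. (\<Sum>i<m. c i * f (a ^ i * (b * k))) * of_real (cot (pi * real k / real N)))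
          = (\<Sum>i<m. c i * (\<Sum>k=1..<N. f (a ^ i * b * k) * of_real (cot (pi * real k / real N))))"
        unfolding sum_distrib_right sum_distrib_left by (subst sum.swap) (simp add: mult_ac)
      also have "\<dots> = (\<Sum>i<m. c i * 0)"
        using a b by (intro sum.cong arg_cong2[where f = "(*)"] f(4)) auto
      finally show ?thesis by simp
    qed
    ultimately show ?thesis
      unfolding P_def odd_periodic_def by (simp add: sum_negf)
  qed
  have "\<exists>g. P g \<and> (\<exists>n. g n \<noteq> 0) \<and> (\<forall>a. coprime a N \<longrightarrow> (\<exists>l. \<forall>n. g (a * n) = l * g n))"
  proof (rule exists_translation_eigenvector)
    show "N > 1" using N by simp
    show "P f" using f cot unfolding P_def by blast
    show "f n \<noteq> 0" by (rule nz)
  qed (use closed in \<open>auto simp: P_def odd_periodic_def\<close>)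
  then obtain g n1 where g: "P g" "g n1 \<noteq> 0" and eig: "\<And>a. coprime a N \<Longrightarrow> \<exists>l. \<forall>n. g (a * n) = l * g n"
    by blast
  have gp: "\<And>n. g (n mod N) = g n" "\<And>n. \<not> coprime n N \<Longrightarrow> g n = 0" "\<And>n. g ((N - 1) * n) = - g n"
    using g(1) unfolding P_def odd_periodic_def by auto
  have "\<forall>a. coprime a N \<longrightarrow> (\<Sum>k=1..<N. g (a * k) * of_real (cot (pi * real k / real N))) = 0"
    using g(1) unfolding P_def by (rule conjunct2)
  from this[rule_format, of 1]
  have gcot: "(\<Sum>k=1..<N. g k * of_real (cot (pi * real k / real N))) = 0" by simp
  have eig1: "g (a * n) * g 1 = g a * g n" if "coprime a N" for a n
  proof -
    obtain l where l: "\<And>n. g (a * n) = l * g n" using eig \<open>coprime a N\<close> by blast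
    then show ?thesis using l[of n] l[of 1] by simp
  qed
  \<comment> \<open>The nonzero value at \<open>n1\<close> forces \<open>n1\<close> to be a unit,
    and then \<open>g (n1 * n1) * g 1 = g n1 * g n1\<close>.\<close>
  have g1: "g 1 \<noteq> 0"
  proof
    assume "g 1 = 0"
    have "coprime n1 N" using g(2) gp(2) by blast
    then show False using eig1[of n1 n1] g(2) \<open>g 1 = 0\<close> by simp
  qed
  define \<psi> where "\<psi> n = g n / g 1" for n
  have mult: "\<psi> (m * n) = \<psi> m * \<psi> n" for m n
  proof (cases "coprime m N")
    case True
    then show ?thesis using eig1[OF True, of n] g1 by (simp add: \<psi>_def field_simps)
  next
    case False
    then show ?thesis using gp(2)[of m] gp(2)[of "m * n"] by (simp add: \<psi>_def)
  qed
  interpret dirichlet_character N \<psi>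
    using N mult gp g1 by unfold_locales (auto simp: \<psi>_def)
  \<comment> \<open>This value serves twice: it witnesses that \<psi> is not principal, and it
    supplies the oddness for the series at 1.\<close>
  have minus: "\<psi> (N - 1) = -1" using gp(3)[of 1] g1 by (simp add: \<psi>_def)
  have "coprime (N - 1) N" using N by (intro coprime_diff_one_left_nat) simp
  moreover have "\<psi> (N - 1) \<noteq> 1" using minus by simp
  ultimately have "\<not> (\<lambda>n. \<psi> (Suc n) / of_nat (Suc n)) sums 0" by (rule L_1_nonzero)
  moreover have "(\<lambda>n. \<psi> (Suc n) / of_nat (Suc n)) sums 0"
  proof -
    have "\<psi> (N - k) = - \<psi> k" if k: "0 < k" "k < N" for k
    proof -
      have "(N - 1) * k + N = N - k + N * k"
        using k by (simp add: algebra_simps diff_mult_distrib)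
      then have "((N - 1) * k) mod N = (N - k) mod N" by (metis mod_add_self2 mod_mult_self2)
      then show ?thesis using mult[of "N - 1" k] minus periodic by (metis mult_minus1)
    qed
    then have "(\<lambda>n. \<psi> n / of_nat n) sums
        (of_real (pi / (2 * real N)) * (\<Sum>k=1..<N. \<psi> k * of_real (cot (pi * real k / real N))))"
      using N periodic zero by (intro odd_periodic_sums) auto
    also have "(\<Sum>k=1..<N. \<psi> k * of_real (cot (pi * real k / real N))) = 0"
      using gcot unfolding \<psi>_def by (simp flip: sum_divide_distrib)
    finally have "(\<lambda>n. \<psi> n / of_nat n) sums 0" by simp
    then show ?thesis using sums_Suc_iff[of "\<lambda>n. \<psi> n / of_nat n" 0] zero by simp
  qed
  ultimately show False by blast
qed

section \<open>Cotangents in the cyclotomic field\<close>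

text \<open>It expresses \<open>1 / (w - 1)\<close>, up to the factor \<open>N\<close>, as an
  integer polynomial in \<open>w\<close>; conjugation can then act on cotangents through
  polynomials.\<close>

lemma sum_nat_mult_powers_root_of_unity:
  fixes w :: complex
  assumes "w ^ N = 1" "w \<noteq> 1"
  shows "(\<Sum>j<N. of_nat j * w ^ j) = of_nat N / (w - 1)"
proof -
  have "(w - 1) * (\<Sum>j<n. of_nat j * w ^ j) = of_nat n * w ^ n - w * (\<Sum>j<n. w ^ j)" for n
    by (induction n) (auto simp: algebra_simps)
  from this[of N] have "(w - 1) * (\<Sum>j<N. of_nat j * w ^ j) = of_nat N"
    using assms by (simp add: geometric_sum)
  then show ?thesis using assms(2) by (simp add: field_simps)
qed

lemma cot_eq_root_of_unity:
  assumes N: "N > 0" and k: "\<not> N dvd k"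
  shows "complex_of_real (cot (pi * real k / real N)) = \<i> * (1 + 2 / (cis (2 * pi / real N) ^ k - 1))"
proof -
  define x where "x = pi * real k / real N"
  have w: "cis (2 * pi / real N) ^ k = cis (2 * x)"
    by (simp add: Complex.DeMoivre x_def mult_ac)
  have ne: "cis (2 * x) \<noteq> 1"
    using cis_2pi_power_eq_1_iff[OF N, of k] k w by simp
  have c: "cis (2 * x) - 1 = 2 * \<i> * of_real (sin x) * cis x"
    by (simp add: complex_eq_iff cos_double_sin sin_double power2_eq_square)
  have sin: "sin x \<noteq> 0" using c ne by auto
  have "\<i> * (1 + 2 / (cis (2 * x) - 1)) = \<i> + inverse (cis x) / of_real (sin x)"
    unfolding c using sin by (simp add: field_simps)
  also have "\<dots> = of_real (cot x)"
    unfolding cis_inverse using sin by (simp add: complex_eq_iff cot_def)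
  finally show ?thesis unfolding w x_def[symmetric] by simp
qed

lemma cot_eq_sum_powers_root_of_unity:
  assumes N: "N > 0" and k: "\<not> N dvd k"
  shows "complex_of_real (cot (pi * real k / real N)) =
    \<i> * (1 + 2 / of_nat N * (\<Sum>j<N. of_nat j * (cis (2 * pi / real N) ^ k) ^ j))"
proof -
  have "(cis (2 * pi / real N) ^ k) ^ N = 1" "cis (2 * pi / real N) ^ k \<noteq> 1"
    using cis_2pi_power_eq_1_iff[OF N, of "k * N"] cis_2pi_power_eq_1_iff[OF N, of k] k
    by (simp_all add: power_mult)
  then show ?thesis
    using N unfolding cot_eq_root_of_unity[OF assms]
    by (subst sum_nat_mult_powers_root_of_unity) auto
qed

text \<open>At multiples of \<open>N\<close> the cotangent has a pole, and both sides are the value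
  0 of a division by zero.\<close>

lemma cot_mod:
  assumes "N > 0"
  shows "cot (pi * real (k mod N) / real N) = cot (pi * real k / real N)"
proof (cases "N dvd k")
  case True
  then obtain j where "k = N * j" by blast
  then show ?thesis using assms cot_npi[of j] by (simp add: mult.commute)
next
  case False
  then have "\<not> N dvd k mod N" by (simp add: dvd_mod_iff)
  moreover have "cis (2 * pi / real N) ^ (k mod N) = cis (2 * pi / real N) ^ k"
    using cis_2pi_power_eq_1_iff[OF assms, of "N * (k div N)"]
    by (metis dvd_triv_left mult_1 power_add mult_div_mod_eq)
  ultimately have "complex_of_real (cot (pi * real (k mod N) / real N)) = of_real (cot (pi * real k / real N))"
    using False assms by (simp add: cot_eq_root_of_unity)
  then show ?thesis by (simp only: of_real_eq_iff)
qed

lemma odd_periodic_sum_eq_0: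
  assumes N: "N > 0" and f: "odd_periodic N f"
  shows "(\<Sum>k<N. f k) = 0"
proof -
  have "(\<Sum>k<N. f k) = (\<Sum>k<N. f ((N - 1) * k mod N))"
    using bij_betw_mult_mod[of "N - 1" N] coprime_diff_one_left_nat[OF N] N
    by (intro sum.reindex_bij_betw[symmetric]) auto
  also have "\<dots> = - (\<Sum>k<N. f k)"
    using f by (simp add: odd_periodic_def sum_negf)
  finally show ?thesis by (simp add: eq_neg_iff_add_eq_0)
qed

text \<open>Each cotangent is the imaginary unit times one plus a polynomial in a root of unity. The
  ones sum to 0 by oddness of \<open>f\<close>, so a cotangent relation is equivalent to the
  vanishing of the left-hand polynomial at the \<open>b\<close>-th power.\<close>

lemma sum_cot_mult_eq:
  assumes N: "N \<ge> 2" and f: "odd_periodic N f" and b: "coprime b N"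
  shows "(\<Sum>k<N. \<Sum>j<N. f k * of_nat j * (cis (2 * pi / real N) ^ b) ^ (k * j))
    = of_nat N / (2 * \<i>) * (\<Sum>k=1..<N. f k * of_real (cot (pi * real (b * k) / real N)))"
proof -
  let ?z = "cis (2 * pi / real N)"
  have f0: "f 0 = 0" using f N by (auto simp: odd_periodic_def)
  have "(\<Sum>j<N. f k * of_nat j * (?z ^ b) ^ (k * j))
      = of_nat N / (2 * \<i>) * (f k * of_real (cot (pi * real (b * k) / real N))) - of_nat N / 2 * f k"
    if k: "k < N" for k
  proof (cases "k = 0")
    case True
    then show ?thesis using f0 by simp
  next
    case False
    then have "\<not> N dvd b * k"
      using k b by (metis coprime_commute coprime_dvd_mult_right_iff dvd_imp_le not_gr_zero not_less)
    then have cot: "complex_of_real (cot (pi * real (b * k) / real N)) =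
        \<i> * (1 + 2 / of_nat N * (\<Sum>j<N. of_nat j * (?z ^ (b * k)) ^ j))"
      using N by (intro cot_eq_sum_powers_root_of_unity) auto
    have "(\<Sum>j<N. f k * of_nat j * (?z ^ b) ^ (k * j)) = f k * (\<Sum>j<N. of_nat j * (?z ^ (b * k)) ^ j)"
      unfolding sum_distrib_left by (simp add: power_mult mult.assoc)
    then show ?thesis unfolding cot using N by (simp add: field_simps)
  qed
  then have "(\<Sum>k<N. \<Sum>j<N. f k * of_nat j * (?z ^ b) ^ (k * j))
      = (\<Sum>k<N. of_nat N / (2 * \<i>) * (f k * of_real (cot (pi * real (b * k) / real N))) - of_nat N / 2 * f k)"
    by (intro sum.cong) auto
  also have "\<dots> = of_nat N / (2 * \<i>) * (\<Sum>k<N. f k * of_real (cot (pi * real (b * k) / real N)))"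
    unfolding sum_subtractf sum_distrib_left[symmetric] using odd_periodic_sum_eq_0[OF _ f] N by simp
  also have "(\<Sum>k<N. f k * of_real (cot (pi * real (b * k) / real N)))
      = (\<Sum>k=1..<N. f k * of_real (cot (pi * real (b * k) / real N)))"
    using f0 by (intro sum.mono_neutral_right) (auto simp: not_le)
  finally show ?thesis .
qed

lemma cot_relation_conjugate:
  assumes N: "N \<ge> 3" and f: "odd_periodic N f" and int: "\<And>n. f n \<in> \<int>"
    and rel: "(\<Sum>k=1..<N. f k * of_real (cot (pi * real k / real N))) = 0"
    and b: "coprime b N"
  shows "(\<Sum>k=1..<N. f k * of_real (cot (pi * real (b * k) / real N))) = 0"
proof -
  define z where "z = cis (2 * pi / real N)"
  define P where "P = (\<Sum>k<N. \<Sum>j<N. Polynomial.monom (f k * of_nat j) (k * j))"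
  have poly: "poly P x = (\<Sum>k<N. \<Sum>j<N. f k * of_nat j * x ^ (k * j))" for x
    unfolding P_def by (simp add: poly_sum poly_monom)
  have "\<forall>i. Polynomial.coeff P i \<in> \<int>"
    unfolding P_def using int by (auto simp: coeff_sum intro!: Ints_sum)
  moreover have "z ^ N = 1"
    using cis_2pi_power_eq_1_iff[of N N] N by (simp add: z_def)
  moreover have "poly P z = 0"
    using sum_cot_mult_eq[of N f 1] N f rel by (simp add: poly z_def)
  ultimately have "poly P (z ^ b) = 0"
    using int_poly_root_of_unity_conjugate[of z N P b] b N by simp
  then show ?thesis
    using sum_cot_mult_eq[of N f b] N f b by (simp add: poly z_def)
qed

text \<open>Conjugation multiplies the argument of the cotangent by \<open>b\<close>. With
  \<open>b\<close> inverse to \<open>a\<close> modulo \<open>N\<close>, permuting the residues moves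
  the multiplier onto \<open>f\<close>.\<close>

lemma cot_relation_translate:
  assumes N: "N \<ge> 3" and f: "odd_periodic N f" and int: "\<And>n. f n \<in> \<int>"
    and rel: "(\<Sum>k=1..<N. f k * of_real (cot (pi * real k / real N))) = 0"
    and a: "coprime a N"
  shows "(\<Sum>k=1..<N. f (a * k) * of_real (cot (pi * real k / real N))) = 0"
proof -
  obtain b where ab: "[a * b = 1] (mod N)" using cong_solve_coprime_nat[OF a] by auto
  then have b: "coprime b N"
    by (metis cong_imp_coprime cong_sym coprime_1_left coprime_mult_left_iff)
  have per: "f (n mod N) = f n" for n using f by (simp add: odd_periodic_def)
  have f0: "f 0 = 0" using f N by (auto simp: odd_periodic_def)
  have "f (a * (b * k mod N)) = f k" for k
  proof -
    have "a * (b * k mod N) mod N = k mod N"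
      using cong_scalar_right[OF ab, of k] by (simp add: cong_def mod_mult_right_eq mult.assoc)
    then show ?thesis by (metis per)
  qed
  then have *: "f (a * (b * k mod N)) * of_real (cot (pi * real (b * k mod N) / real N))
      = f k * of_real (cot (pi * real (b * k) / real N))" for k
    using N by (simp add: cot_mod del: of_nat_mult)
  have "(\<Sum>k=1..<N. f (a * k) * of_real (cot (pi * real k / real N)))
      = (\<Sum>k<N. f (a * k) * of_real (cot (pi * real k / real N)))"
    using f0 by (intro sum.mono_neutral_left) (auto simp: not_le)
  also have "\<dots> = (\<Sum>k<N. f (a * (b * k mod N)) * of_real (cot (pi * real (b * k mod N) / real N)))"
    using bij_betw_mult_mod[OF b] N by (intro sum.reindex_bij_betw[symmetric]) auto
  also have "\<dots> = (\<Sum>k<N. f k * of_real (cot (pi * real (b * k) / real N)))"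
    unfolding * ..
  also have "\<dots> = (\<Sum>k=1..<N. f k * of_real (cot (pi * real (b * k) / real N)))"
    using f0 by (intro sum.mono_neutral_right) (auto simp: not_le)
  also have "\<dots> = 0" by (rule cot_relation_conjugate[OF N f int rel b])
  finally show ?thesis .
qed

text \<open>In the expansion by powers of roots of unity, summing over \<open>l\<close> keeps only
  the exponents divisible by \<open>p\<close>. The surviving sum has the shape
  \<open>\<Sum>t<M. t * w ^ t\<close> with \<open>w ^ M = 1\<close>, and is evaluated by the same
  identity.\<close>

lemma cot_distribution:
  assumes N: "N > 0" and p: "p > 0" "p dvd N" and j: "\<not> N dvd p * j"
  shows "(\<Sum>l<p. cot (pi * real (j + l * (N div p)) / real N)) = real p * cot (pi * real (p * j) / real N)"
proof -
  define z where "z = cis (2 * pi / real N)"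
  define M where "M = N div p"
  have NpM: "N = p * M" using p by (simp add: M_def)
  have M: "M > 0" using N NpM by simp
  have zM: "z ^ M = cis (2 * pi / real p)"
    using M p unfolding z_def NpM by (simp add: Complex.DeMoivre)
  have ndvd: "\<not> N dvd j + l * M" for l
  proof
    assume "N dvd j + l * M"
    then have "N dvd p * (j + l * M)" by simp
    then have "N dvd p * j + l * N" by (simp add: NpM algebra_simps)
    then show False using j by (simp add: dvd_add_left_iff)
  qed
  have inner: "(\<Sum>l<p. (z ^ (j + l * M)) ^ i) = (if p dvd i then of_nat p * z ^ (j * i) else 0)" for i
  proof -
    have "(\<Sum>l<p. (z ^ (j + l * M)) ^ i) = z ^ (j * i) * (\<Sum>l<p. ((z ^ M) ^ i) ^ l)"
      unfolding sum_distrib_left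
      by (intro sum.cong refl) (simp add: algebra_simps flip: power_mult power_add)
    then show ?thesis
      unfolding zM sum_powers_root_of_unity[OF p(1)] by simp
  qed
  have wM: "(z ^ (p * j)) ^ M = 1" "z ^ (p * j) \<noteq> 1"
    using cis_2pi_power_eq_1_iff[OF N, of "p * j * M"] cis_2pi_power_eq_1_iff[OF N, of "p * j"] j
    unfolding z_def by (auto simp: NpM simp flip: power_mult)
  have "(\<Sum>l<p. \<Sum>i<N. of_nat i * (z ^ (j + l * M)) ^ i)
      = (\<Sum>i<N. of_nat i * (\<Sum>l<p. (z ^ (j + l * M)) ^ i))"
    unfolding sum_distrib_left by (rule sum.swap)
  also have "\<dots> = (\<Sum>i<N. if p dvd i then of_nat i * (of_nat p * z ^ (j * i)) else 0)"
    unfolding inner by (intro sum.cong) auto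
  also have "\<dots> = (\<Sum>i\<in>{i\<in>{..<N}. p dvd i}. of_nat i * (of_nat p * z ^ (j * i)))"
    by (rule sum.inter_filter[symmetric]) simp
  also have "\<dots> = (\<Sum>t<M. of_nat (p * t) * (of_nat p * z ^ (j * (p * t))))"
    using p by (intro sum.reindex_bij_witness[of _ "\<lambda>t. p * t" "\<lambda>i. i div p"])
      (auto simp: NpM elim!: dvdE)
  also have "\<dots> = of_nat p * of_nat p * (\<Sum>t<M. of_nat t * (z ^ (p * j)) ^ t)"
    unfolding sum_distrib_left by (intro sum.cong refl) (simp add: mult_ac flip: power_mult)
  also have "\<dots> = of_nat p * of_nat N / (z ^ (p * j) - 1)"
    unfolding sum_nat_mult_powers_root_of_unity[OF wM] by (simp add: NpM)
  finally have dbl: "(\<Sum>l<p. \<Sum>i<N. of_nat i * (z ^ (j + l * M)) ^ i) = of_nat p * of_nat N / (z ^ (p * j) - 1)" .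
  have "(\<Sum>l<p. complex_of_real (cot (pi * real (j + l * M) / real N)))
      = (\<Sum>l<p. \<i> * (1 + 2 / of_nat N * (\<Sum>i<N. of_nat i * (z ^ (j + l * M)) ^ i)))"
    unfolding z_def using cot_eq_sum_powers_root_of_unity[OF N ndvd] by (intro sum.cong refl)
  also have "\<dots> = \<i> * (of_nat p + 2 / of_nat N * (\<Sum>l<p. \<Sum>i<N. of_nat i * (z ^ (j + l * M)) ^ i))"
    by (simp add: sum.distrib sum_distrib_left distrib_left)
  also have "\<dots> = of_nat p * (\<i> * (1 + 2 / (z ^ (p * j) - 1)))"
    unfolding dbl using N by (simp add: field_simps)
  also have "\<dots> = of_nat p * of_real (cot (pi * real (p * j) / real N))"
    unfolding z_def using cot_eq_root_of_unity[OF N j] by simp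
  finally have "complex_of_real (\<Sum>l<p. cot (pi * real (j + l * M) / real N))
      = of_real (real p * cot (pi * real (p * j) / real N))" by simp
  then show ?thesis unfolding M_def by (simp only: of_real_eq_iff)
qed

section \<open>The span of the cotangents\<close>

definition cot_span :: "nat \<Rightarrow> real set" where
  "cot_span N = {x. \<exists>c :: nat \<Rightarrow> rat. x = (\<Sum>k\<in>prim_idx N. of_rat (c k) * cot (pi * real k / real N))}"

lemma finite_prim_idx: "finite (prim_idx N)"
  unfolding prim_idx_def by (rule finite_subset[of _ "{..N}"]) auto

lemma cot_span_add: "x \<in> cot_span N \<Longrightarrow> y \<in> cot_span N \<Longrightarrow> x + y \<in> cot_span N"
proof -
  assume "x \<in> cot_span N" "y \<in> cot_span N"
  then obtain c d :: "nat \<Rightarrow> rat" where "x = (\<Sum>k\<in>prim_idx N. of_rat (c k) * cot (pi * real k / real N))"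
    "y = (\<Sum>k\<in>prim_idx N. of_rat (d k) * cot (pi * real k / real N))"
    unfolding cot_span_def by blast
  then show ?thesis unfolding cot_span_def
    by (intro CollectI exI[of _ "\<lambda>k. c k + d k"]) (simp add: of_rat_add distrib_right sum.distrib)
qed

lemma cot_span_scale: "x \<in> cot_span N \<Longrightarrow> of_rat q * x \<in> cot_span N"
proof -
  assume "x \<in> cot_span N"
  then obtain c :: "nat \<Rightarrow> rat" where "x = (\<Sum>k\<in>prim_idx N. of_rat (c k) * cot (pi * real k / real N))"
    unfolding cot_span_def by blast
  then show ?thesis unfolding cot_span_def
    by (intro CollectI exI[of _ "\<lambda>k. q * c k"]) (simp add: of_rat_mult sum_distrib_left mult.assoc)
qed

lemma cot_span_0: "0 \<in> cot_span N"
  unfolding cot_span_def by (intro CollectI exI[of _ "\<lambda>_. 0"]) simp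

lemma cot_span_sum: "(\<And>i. i \<in> I \<Longrightarrow> f i \<in> cot_span N) \<Longrightarrow> sum f I \<in> cot_span N"
  by (induction I rule: infinite_finite_induct) (auto intro: cot_span_add cot_span_0)

lemma cot_span_prim_idx: "k \<in> prim_idx N \<Longrightarrow> cot (pi * real k / real N) \<in> cot_span N"
  unfolding cot_span_def
  by (intro CollectI exI[of _ "\<lambda>i. if i = k then 1 else 0"])
    (simp add: finite_prim_idx if_distrib[of of_rat] if_distrib[of "\<lambda>x. x * _"] cong: if_cong)

lemma cot_reflect:
  assumes "k \<le> N" "N > 0"
  shows "cot (pi * real (N - k) / real N) = - cot (pi * real k / real N)"
proof -
  have "pi * real (N - k) / real N = pi - pi * real k / real N"
    using assms by (simp add: of_nat_diff field_simps)
  then show ?thesis by (simp add: cot_def)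
qed

lemma coprime_diff_self:
  fixes k N :: nat
  assumes "k \<le> N"
  shows "coprime (N - k) N \<longleftrightarrow> coprime k N"
  using assms by (metis coprime_commute coprime_iff_gcd_eq_1 gcd_diff2_nat gcd.commute le_add_diff_inverse gcd_add1)

lemma prim_idx_cases:
  assumes N: "N \<ge> 3" and k: "k < N" "coprime k N"
  shows "k \<in> prim_idx N \<or> N - k \<in> prim_idx N"
proof -
  have "k > 0" using k N by (cases "k = 0") auto
  have "2 * k \<noteq> N"
  proof
    assume "2 * k = N"
    then have "k dvd N" by auto
    then have "k = 1" using k(2) by (metis coprime_common_divisor_nat dvd_refl)
    then show False using \<open>2 * k = N\<close> N by simp
  qed
  then have "2 * k < N \<or> 2 * (N - k) < N" using k(1) by linarith
  then show ?thesis
  proof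
    assume "2 * k < N"
    then show ?thesis using k \<open>k > 0\<close> by (simp add: prim_idx_def)
  next
    assume "2 * (N - k) < N"
    then show ?thesis using k by (auto simp: prim_idx_def coprime_diff_self less_imp_le Suc_le_eq)
  qed
qed

lemma cot_span_coprime:
  assumes N: "N \<ge> 3" and k: "coprime k N"
  shows "cot (pi * real k / real N) \<in> cot_span N"
proof -
  define r where "r = k mod N"
  have r: "r < N" "coprime r N" using N k by (auto simp: r_def)
  have "cot (pi * real r / real N) \<in> cot_span N"
    using prim_idx_cases[OF N r]
  proof
    assume "N - r \<in> prim_idx N"
    then have "of_rat (-1) * cot (pi * real (N - r) / real N) \<in> cot_span N"
      by (intro cot_span_scale cot_span_prim_idx)
    then show ?thesis using cot_reflect[of r N] r N by simp
  qed (rule cot_span_prim_idx)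
  then show ?thesis using N cot_mod[of N k] by (simp add: r_def)
qed

text \<open>Strong induction on \<open>g = gcd j N\<close>, removing a prime \<open>p\<close> from \<open>g\<close> by the distribution relation. If
  \<open>p\<close> also divides \<open>N / g\<close>, all terms of the relation have smaller gcd. Otherwise exactly one term
  keeps the gcd, which gives \<open>cot (i) \<equiv> p * cot (p * i)\<close> modulo the span; iterating this along the order of
  \<open>p\<close> modulo \<open>N / g\<close> returns to \<open>i\<close>.\<close>

lemma cot_span_all:
  assumes N: "N \<ge> 3" and "\<not> N dvd j"
  shows "cot (pi * real j / real N) \<in> cot_span N"
  using assms(2)
proof (induction "gcd j N" arbitrary: j rule: less_induct)
  case less
  define C where "C k = cot (pi * real k / real N)" for k
  define g where "g = gcd j N"
  have IH: "C k \<in> cot_span N" if "gcd k N dvd g" "gcd k N \<noteq> g" for k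
  proof -
    have "g > 0" using N by (simp add: g_def)
    then have lt: "gcd k N < g" using that by (simp add: dvd_imp_le le_neq_implies_less)
    have "\<not> N dvd k"
    proof
      assume "N dvd k"
      then have "N < g" using lt by (simp add: gcd_nat.absorb2)
      moreover have "g \<le> N" unfolding g_def using N by (intro dvd_imp_le) auto
      ultimately show False by linarith
    qed
    then show ?thesis using less.hyps[of k] lt unfolding g_def C_def by blast
  qed
  show ?case
  proof (cases "g = 1")
    case True
    then show ?thesis unfolding g_def by (intro cot_span_coprime N gcd_eq_1_imp_coprime)
  next
    case False
    then obtain p where p: "prime p" "p dvd g" by (metis prime_factor_nat)
    have p0: "p > 0" "p > 1" using prime_gt_0_nat[OF p(1)] prime_gt_1_nat[OF p(1)] by auto
    have pN: "p dvd N" using p(2) unfolding g_def by (rule dvd_trans) simp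
    define M where "M = N div p"
    have NpM: "N = p * M" using pN by (simp add: M_def)
    have dist: "(\<Sum>l<p. C (i + l * M)) = real p * C (p * i)" if "\<not> N dvd p * i" for i
      using cot_distribution[of N p i] p0 pN that N by (simp add: C_def M_def)
    define N' where "N' = N div g"
    have NgN: "N = g * N'" by (simp add: N'_def g_def)
    have g0: "g > 0" "N' > 0" using N NgN by (auto intro!: Nat.gr0I)
    \<comment> \<open>Multiplying \<open>i + l * M\<close> by \<open>p\<close> gives
      \<open>p * i + l * N\<close>, so no term of the distribution relation has a gcd outside the
      divisors of that of \<open>p * i\<close>.\<close>
    have gcd_term: "gcd (i + l * M) N dvd gcd (p * i) N" for i l
    proof -
      have "gcd (i + l * M) N dvd p * (i + l * M)" by (meson dvd_mult gcd_dvd1)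
      also have "p * (i + l * M) = p * i + l * N" by (simp add: NpM algebra_simps)
      finally have "gcd (i + l * M) N dvd p * i" using dvd_add_left_iff[of _ "l * N" "p * i"] by simp
      then show ?thesis by simp
    qed
    show ?thesis
    proof (cases "p dvd N'")
      case True
      obtain j1 where j1: "j = p * j1" using p(2) unfolding g_def by (metis dvdE dvd_trans gcd_dvd1)
      have "C (j1 + l * M) \<in> cot_span N" for l
      proof (rule IH)
        show "gcd (j1 + l * M) N dvd g" using gcd_term[of j1 l] by (simp add: g_def j1)
        show "gcd (j1 + l * M) N \<noteq> g"
        proof
          assume "gcd (j1 + l * M) N = g"
          then have "g dvd j1 + l * M" using gcd_dvd1[of "j1 + l * M" N] by simp
          then have "p * g dvd p * (j1 + l * M)" by (rule mult_dvd_mono[OF dvd_refl])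
          then have "p * g dvd j + l * N" by (simp add: j1 NpM algebra_simps)
          moreover have pgN: "p * g dvd N"
            unfolding NgN mult.commute[of p] by (rule mult_dvd_mono[OF dvd_refl True])
          ultimately have "p * g dvd j" using dvd_add_left_iff[of "p * g" "l * N" j] by simp
          then have "p * g dvd g" using pgN unfolding g_def by (intro gcd_greatest)
          then show False using g0 p0 dvd_imp_le[of "p * g" g] by simp
        qed
      qed
      then have "(\<Sum>l<p. C (j1 + l * M)) \<in> cot_span N" by (intro cot_span_sum)
      then have "of_rat (1 / of_nat p) * (real p * C j) \<in> cot_span N"
        using dist[of j1] less.prems by (intro cot_span_scale) (simp add: j1)
      then show ?thesis using p0 by (simp add: of_rat_divide C_def)
    next
      case False
      have cop: "coprime p N'" using False p(1) by (simp add: prime_imp_coprime)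
      have gcd_mult: "gcd (p * i) N = g" if gi: "gcd i N = g" for i
      proof -
        have "g dvd i" using gcd_dvd1[of i N] gi by simp
        then obtain i' where i': "i = g * i'" by (rule dvdE)
        have "g * gcd i' N' = g"
          using gi unfolding i' gcd_mult_distrib_nat by (simp only: NgN[symmetric])
        then have "coprime i' N'" using g0 by (intro gcd_eq_1_imp_coprime) simp
        then have "coprime (p * i') N'" using cop by simp
        then have "g * gcd (p * i') N' = g" by simp
        then show ?thesis
          unfolding i' gcd_mult_distrib_nat by (simp only: NgN[symmetric] mult.left_commute)
      qed
      have ndvd: "\<not> N dvd i" if "gcd i N = g" for i
      proof
        assume "N dvd i"
        then have "g = N" using that by (simp add: gcd_nat.absorb2)
        then have "N dvd j" using gcd_dvd1[of j N] by (simp add: g_def)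
        then show False using less.prems by simp
      qed
      have step: "real p * C (p * i) - C i \<in> cot_span N" if i: "gcd i N = g" for i
      proof -
        have "C (i + l * M) \<in> cot_span N" if l: "l \<in> {1..<p}" for l
        proof (rule IH)
          show "gcd (i + l * M) N dvd g" using gcd_term[of i l] gcd_mult[OF i] by simp
          show "gcd (i + l * M) N \<noteq> g"
          proof
            assume *: "gcd (i + l * M) N = g"
            then have "g dvd i + l * M" using gcd_dvd1[of "i + l * M" N] by simp
            moreover have "g dvd i" using gcd_dvd1[of i N] i by simp
            ultimately have "g dvd l * M" using dvd_add_right_iff by blast
            then have "p * g dvd p * (l * M)" by (intro mult_dvd_mono) auto
            also have "p * (l * M) = l * N" by (simp add: NpM mult_ac)
            also have "\<dots> = g * (l * N')" by (subst NgN) (simp add: mult_ac)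
            finally have "g * p dvd g * (l * N')" by (simp add: mult.commute)
            then have "p dvd l * N'" using g0 by simp
            then have "p dvd l" using False p(1) by (simp add: prime_dvd_mult_iff)
            then show False using l by (auto dest: dvd_imp_le)
          qed
        qed
        then have "(\<Sum>l\<in>{1..<p}. C (i + l * M)) \<in> cot_span N" by (intro cot_span_sum)
        moreover have "(\<Sum>l<p. C (i + l * M)) = C i + (\<Sum>l\<in>{1..<p}. C (i + l * M))"
        proof -
          have "{..<p} = insert 0 {1..<p}" using p0 by auto
          then show ?thesis by simp
        qed
        moreover have "(\<Sum>l<p. C (i + l * M)) = real p * C (p * i)"
          using dist[OF ndvd[OF gcd_mult[OF i]]] .
        ultimately show ?thesis by simp
      qed
      have iter: "gcd (p ^ m * j) N = g \<and> real p ^ m * C (p ^ m * j) - C j \<in> cot_span N" for m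
      proof (induction m)
        case 0
        then show ?case by (simp add: g_def cot_span_0)
      next
        case (Suc m)
        then have gcd: "gcd (p ^ m * j) N = g" by blast
        have "gcd (p ^ Suc m * j) N = g" using gcd_mult[OF gcd] by (simp add: mult.assoc)
        moreover have "of_rat (of_nat (p ^ m)) * (real p * C (p * (p ^ m * j)) - C (p ^ m * j)) \<in> cot_span N"
          by (intro cot_span_scale step gcd)
        then have "of_rat (of_nat (p ^ m)) * (real p * C (p * (p ^ m * j)) - C (p ^ m * j))
            + (real p ^ m * C (p ^ m * j) - C j) \<in> cot_span N"
          using Suc by (intro cot_span_add) auto
        then have "real p ^ Suc m * C (p ^ Suc m * j) - C j \<in> cot_span N"
          by (simp add: of_rat_power algebra_simps)
        ultimately show ?case by blast
      qed
      \<comment> \<open>Euler's theorem makes \<open>p ^ m * j\<close> congruent to \<open>j\<close>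
        modulo \<open>N\<close>, so the iterated relation puts \<open>(p ^ m - 1) * C j\<close> into
        the span, with a nonzero factor because \<open>m > 0\<close>.\<close>
      define m where "m = totient N'"
      have m: "m > 0" using g0 by (simp add: m_def)
      have "C (p ^ m * j) = C j"
      proof -
        have "g dvd j" by (simp add: g_def)
        then obtain j' where j': "j = g * j'" by (rule dvdE)
        have "[p ^ m * j' = 1 * j'] (mod N')"
          unfolding m_def using euler_theorem[OF cop] by (rule cong_scalar_right)
        then have "(g * (p ^ m * j')) mod (g * N') = (g * j') mod (g * N')"
          by (simp add: cong_def flip: mult_mod_right)
        then have "(p ^ m * j) mod N = j mod N"
          unfolding NgN[symmetric] j' by (simp add: mult.left_commute)
        then show ?thesis using cot_mod[of N "p ^ m * j"] cot_mod[of N j] N by (simp only: C_def)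
      qed
      then have "real p ^ m * C j - C j \<in> cot_span N" using iter[of m] by simp
      then have "of_rat (1 / (of_nat p ^ m - 1)) * (real p ^ m * C j - C j) \<in> cot_span N"
        by (rule cot_span_scale)
      moreover have "real p ^ m > 1" using p0 m by (intro one_less_power) auto
      then have "of_rat (1 / (of_nat p ^ m - 1)) * (real p ^ m * C j - C j) = C j"
        by (simp add: of_rat_divide of_rat_diff of_rat_power field_simps)
      ultimately have "C j \<in> cot_span N" by (simp only:)
      then show ?thesis by (simp add: C_def)
    qed
  qed
qed

section \<open>Dimension and linear independence\<close>

lemma card_prim_idx:
  assumes N: "N \<ge> 3"
  shows "2 * card (prim_idx N) = totient N"
proof -
  have "totatives N = prim_idx N \<union> (\<lambda>k. N - k) ` prim_idx N"
  proof
    show "totatives N \<subseteq> prim_idx N \<union> (\<lambda>k. N - k) ` prim_idx N"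
    proof
      fix k assume "k \<in> totatives N"
      then have k: "0 < k" "k \<le> N" "coprime k N" by (auto simp: totatives_def)
      then have "k < N" using N by (cases "k = N") auto
      then show "k \<in> prim_idx N \<union> (\<lambda>k. N - k) ` prim_idx N"
        using prim_idx_cases[OF N _ k(3)] k by (auto intro!: image_eqI[of _ _ "N - k"])
    qed
    show "prim_idx N \<union> (\<lambda>k. N - k) ` prim_idx N \<subseteq> totatives N"
      by (auto simp: prim_idx_def totatives_def coprime_diff_self)
  qed
  moreover have "card (prim_idx N \<union> (\<lambda>k. N - k) ` prim_idx N) = card (prim_idx N) + card ((\<lambda>k. N - k) ` prim_idx N)"
    by (intro card_Un_disjoint) (auto simp: finite_prim_idx, auto simp: prim_idx_def)
  moreover have "card ((\<lambda>k. N - k) ` prim_idx N) = card (prim_idx N)"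
    by (intro card_image) (auto simp: inj_on_def prim_idx_def)
  ultimately show ?thesis by (simp add: totient_def)
qed

text \<open>Coefficients on half of the units, reflected with a sign to the other half. They are
  integers because the conjugation argument works with integer polynomials.\<close>

definition odd_extension :: "nat \<Rightarrow> (nat \<Rightarrow> int) \<Rightarrow> nat \<Rightarrow> complex" where
  "odd_extension N d n = (if n mod N \<in> prim_idx N then of_int (d (n mod N))
     else if N - n mod N \<in> prim_idx N then - of_int (d (N - n mod N)) else 0)"

lemma odd_extension_reflect:
  assumes "k \<le> N" "k > 0"
  shows "odd_extension N d (N - k) = - odd_extension N d k"
proof (cases "k = N")
  case True
  then show ?thesis by (simp add: odd_extension_def prim_idx_def)
next
  case False
  have "\<not> (k \<in> prim_idx N \<and> N - k \<in> prim_idx N)" by (auto simp: prim_idx_def)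
  then show ?thesis using assms False by (auto simp: odd_extension_def)
qed

lemma odd_periodic_odd_extension:
  assumes N: "N \<ge> 3"
  shows "odd_periodic N (odd_extension N d)"
  unfolding odd_periodic_def
proof (intro conjI allI impI)
  fix n
  show per: "odd_extension N d (n mod N) = odd_extension N d n" for n by (simp add: odd_extension_def)
  show "odd_extension N d n = 0" if "\<not> coprime n N"
  proof -
    have "n mod N \<le> N" using N by (simp add: less_imp_le)
    moreover have "\<not> coprime (n mod N) N" using that N by simp
    ultimately show ?thesis
      using coprime_diff_self[of "n mod N" N] by (simp add: odd_extension_def prim_idx_def)
  qed
  show "odd_extension N d ((N - 1) * n) = - odd_extension N d n"
  proof -
    define r where "r = n mod N"
    have r: "r < N" using N by (simp add: r_def)
    have "(N - 1) * n + n = N * n" using N by (simp add: diff_mult_distrib)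
    then have "((N - 1) * n + n) mod N = 0" by simp
    moreover have "(N - r + n) mod N = 0"
      using r mod_add_right_eq[of "N - r" n N] by (simp flip: r_def)
    ultimately have "[(N - 1) * n + n = N - r + n] (mod N)" by (simp only: cong_def)
    then have "((N - 1) * n) mod N = (N - r) mod N"
      by (simp only: cong_add_rcancel_nat) (simp only: cong_def)
    then have "odd_extension N d ((N - 1) * n) = odd_extension N d (N - r)" by (metis per)
    moreover have "odd_extension N d (N - r) = - odd_extension N d r"
    proof (cases "r = 0")
      case True
      then show ?thesis by (simp add: odd_extension_def prim_idx_def)
    next
      case False
      then show ?thesis using r by (intro odd_extension_reflect) auto
    qed
    ultimately show ?thesis using per[of n] by (simp add: r_def)
  qed
qed

text \<open>After clearing denominators by \<open>D\<close>, the relation over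
  \<open>prim_idx N\<close> becomes half of one over all residues for the odd extension. All its
  translates then hold, which forces the extension to vanish.\<close>

lemma cot_linear_independent:
  fixes c :: "nat \<Rightarrow> rat"
  assumes N: "N \<ge> 3" and rel: "(\<Sum>k\<in>prim_idx N. of_rat (c k) * cot (pi * real k / real N)) = (0::real)"
    and k: "k \<in> prim_idx N"
  shows "c k = 0"
proof -
  obtain D :: int where D: "D > 0" "\<And>k. k \<in> prim_idx N \<Longrightarrow> of_int D * c k \<in> \<int>"
    using exists_common_denominator[OF finite_prim_idx[of N], where f = c] by blast
  define d where "d k = \<lfloor>of_int D * c k\<rfloor>" for k
  have d: "of_int (d k) = of_int D * c k" if "k \<in> prim_idx N" for k
    using D(2)[OF that] by (simp add: d_def)
  have dr: "real_of_int (d k) = of_int D * of_rat (c k)" if "k \<in> prim_idx N" for k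
    using arg_cong[OF d[OF that], of "of_rat :: rat \<Rightarrow> real"] by (simp add: of_rat_mult)
  define f where "f = odd_extension N d"
  have f: "odd_periodic N f" unfolding f_def by (rule odd_periodic_odd_extension[OF N])
  let ?C = "\<lambda>k. complex_of_real (cot (pi * real k / real N))"
  have "(\<Sum>k=1..<N. f k * ?C k) = (\<Sum>k\<in>prim_idx N \<union> (\<lambda>k. N - k) ` prim_idx N. f k * ?C k)"
  proof (rule sum.mono_neutral_right)
    show "\<forall>k\<in>{1..<N} - (prim_idx N \<union> (\<lambda>k. N - k) ` prim_idx N). f k * ?C k = 0"
    proof
      fix k assume k: "k \<in> {1..<N} - (prim_idx N \<union> (\<lambda>k. N - k) ` prim_idx N)"
      have "N - k \<notin> prim_idx N"
      proof
        assume "N - k \<in> prim_idx N"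
        then have "N - (N - k) \<in> (\<lambda>k. N - k) ` prim_idx N" by blast
        then show False using k by simp
      qed
      then show "f k * ?C k = 0" using k by (simp add: f_def odd_extension_def)
    qed
  qed (auto simp: prim_idx_def)
  also have "\<dots> = (\<Sum>k\<in>prim_idx N. f k * ?C k) + (\<Sum>k\<in>(\<lambda>k. N - k) ` prim_idx N. f k * ?C k)"
    by (intro sum.union_disjoint) (auto simp: finite_prim_idx, auto simp: prim_idx_def)
  also have "(\<Sum>k\<in>(\<lambda>k. N - k) ` prim_idx N. f k * ?C k) = (\<Sum>k\<in>prim_idx N. f (N - k) * ?C (N - k))"
    by (rule sum.reindex_cong[of "\<lambda>k. N - k"]) (auto simp: inj_on_def prim_idx_def)
  \<comment> \<open>Under \<open>k \<mapsto> N - k\<close> both factors change sign, so the two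
    halves agree.\<close>
  also have "\<dots> = (\<Sum>k\<in>prim_idx N. f k * ?C k)"
  proof (intro sum.cong refl)
    fix k assume "k \<in> prim_idx N"
    then have "0 < k" "k \<le> N" by (auto simp: prim_idx_def)
    then show "f (N - k) * ?C (N - k) = f k * ?C k"
      using cot_reflect[of k N] odd_extension_reflect[of k N d] by (simp add: f_def)
  qed
  also have "(\<Sum>k\<in>prim_idx N. f k * ?C k) = of_real (of_int D * (\<Sum>k\<in>prim_idx N. of_rat (c k) * cot (pi * real k / real N)))"
    unfolding sum_distrib_left of_real_sum
  proof (intro sum.cong refl)
    fix k assume k: "k \<in> prim_idx N"
    then have "f k = of_real (real_of_int (d k))" by (auto simp: f_def odd_extension_def prim_idx_def)
    then show "f k * ?C k = of_real (of_int D * (of_rat (c k) * cot (pi * real k / real N)))"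
      unfolding dr[OF k] by simp
  qed
  also have "\<dots> = 0" unfolding rel by simp
  finally have "(\<Sum>k=1..<N. f k * ?C k) = 0" by simp
  moreover have "f n \<in> \<int>" for n by (auto simp: f_def odd_extension_def)
  ultimately have "f k = 0"
    using cot_relation_translate[OF N f] by (intro cot_translates_eq_0_imp_eq_0[OF N f]) blast
  then have "d k = 0" using k by (auto simp: f_def odd_extension_def prim_idx_def)
  then show ?thesis using d[OF k] D(1) by simp
qed

theorem theorem2:
  fixes N :: nat
  assumes "N \<ge> 3"
  shows "inj_on (scale N) (prim_idx N)
    \<and> (\<forall>c :: nat \<Rightarrow> rat.
          (\<Sum>k\<in>prim_idx N. of_rat (c k) * scale N k) = 0 \<longrightarrow> (\<forall>k\<in>prim_idx N. c k = 0))
    \<and> (\<forall>j\<in>scale_idx N. \<exists>c :: nat \<Rightarrow> rat.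
          scale N j = (\<Sum>k\<in>prim_idx N. of_rat (c k) * scale N k))
    \<and> card (scale N ` prim_idx N) = totient N div 2"
proof -
  have scale: "scale N k = tan (pi / real N) * cot (pi * real k / real N)" for k
    by (simp add: scale_def cot_altdef divide_inverse mult.commute)
  have "tan (pi / real N) > 0"
    using assms by (intro tan_gt_zero) (auto simp: field_simps)
  have indep: "\<forall>k\<in>prim_idx N. c k = 0"
    if rel: "(\<Sum>k\<in>prim_idx N. of_rat (c k) * scale N k) = 0" for c :: "nat \<Rightarrow> rat"
  proof -
    have "(\<Sum>k\<in>prim_idx N. of_rat (c k) * scale N k)
        = tan (pi / real N) * (\<Sum>k\<in>prim_idx N. of_rat (c k) * cot (pi * real k / real N))"
      unfolding scale sum_distrib_left by (simp add: mult_ac)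
    then have "(\<Sum>k\<in>prim_idx N. of_rat (c k) * cot (pi * real k / real N)) = (0::real)"
      using rel \<open>tan (pi / real N) > 0\<close> by simp
    then show ?thesis using cot_linear_independent[OF assms] by blast
  qed
  have span: "\<exists>c :: nat \<Rightarrow> rat. scale N j = (\<Sum>k\<in>prim_idx N. of_rat (c k) * scale N k)"
    if j: "j \<in> scale_idx N" for j
  proof -
    have "\<not> N dvd j" using j by (auto simp: scale_idx_def dest: dvd_imp_le)
    then obtain c :: "nat \<Rightarrow> rat" where
      "cot (pi * real j / real N) = (\<Sum>k\<in>prim_idx N. of_rat (c k) * cot (pi * real k / real N))"
      using cot_span_all[OF assms] unfolding cot_span_def by blast
    then have "scale N j = (\<Sum>k\<in>prim_idx N. of_rat (c k) * scale N k)"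
      unfolding scale by (simp add: sum_distrib_left mult_ac)
    then show ?thesis by blast
  qed
  \<comment> \<open>Independence is indexed by \<open>k\<close>, whereas the dimension counts
    values. Two equal scales would satisfy the relation with coefficients 1 and -1.\<close>
  have inj: "inj_on (scale N) (prim_idx N)"
  proof (rule inj_onI, rule ccontr)
    fix x y assume xy: "x \<in> prim_idx N" "y \<in> prim_idx N" "scale N x = scale N y" "x \<noteq> y"
    define c :: "nat \<Rightarrow> rat" where "c k = (if k = x then 1 else if k = y then -1 else 0)" for k
    have "(\<Sum>k\<in>prim_idx N. of_rat (c k) * scale N k) = (\<Sum>k\<in>{x, y}. of_rat (c k) * scale N k)"
      using xy finite_prim_idx by (intro sum.mono_neutral_right) (auto simp: c_def)
    also have "\<dots> = 0" using xy by (simp add: c_def)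
    finally have "c x = 0" using indep xy(1) by blast
    then show False by (simp add: c_def)
  qed
  then have "card (scale N ` prim_idx N) = totient N div 2"
    using card_prim_idx[OF assms] by (simp add: card_image)
  moreover have "\<forall>c :: nat \<Rightarrow> rat. (\<Sum>k\<in>prim_idx N. of_rat (c k) * scale N k) = 0 \<longrightarrow> (\<forall>k\<in>prim_idx N. c k = 0)"
    using indep by simp
  moreover have "\<forall>j\<in>scale_idx N. \<exists>c :: nat \<Rightarrow> rat. scale N j = (\<Sum>k\<in>prim_idx N. of_rat (c k) * scale N k)"
    using span by simp
  ultimately show ?thesis using inj by (intro conjI)
qed

end
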